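(* Let $T$ be a tree with $n$ vertices. Then for every $1\leq j\leq n$, \[ I_j(T,X)=\left\langle\, d(\mathcal{M},X)\;\middle|\; \mathcal{M}\in \mathcal{V}_2^*(T^\ell,j)\right\rangle\subseteq\mathbb{Z}[X_T]. \]
   Context: A tree is a simple connected graph without cycles. For a graph $G$ with vertex set $V$, let $X_G=\{x_u\mid u\in V\}$ be indeterminates and let the generalized Laplacian $L(G,X_G)$ be the $V\times V$ matrix with $L_{u,u}=x_u$ and $L_{u,v}=-m_{uv}$ for $u\neq v$, where $m_{uv}$ is the number of edges between $u$ and $v$. The $j$-critical ideal $I_j(G,X_G)$ is the ideal of $\mathbb{Z}[X_G]$ generated by all $j\times j$ minors of $L(G,X_G)$. A $2$-matching of a graph (loops allowed) is a set $\mathcal{M}$ of edges such that every vertex is incident to at most two edges of $\mathcal{M}$, where a loop $vv$ counts twice as incident to $v$ but counts as one edge of $\mathcal{M}$; $|\mathcal{M}|$ is its number of edges. $T^\ell$ denotes the graph obtained from $T$ by adding one loop at each vertex. For a $2$-matching $\mathcal{M}$ of $T^\ell$, $\ell(\mathcal{M})$ is the set of loops in $\mathcal{M}$. $\mathcal{V}_2(T^\ell,j)$ is the set of $2$-matchings of $T^\ell$ of size $j$. A $2$-matching $\mathcal{M}$ of $T^\ell$ is minimal if there is no $2$-matching $\mathcal{M}'$ of $T^\ell$ with $|\mathcal{M}'|=|\mathcal{M}|$ and $\ell(\mathcal{M}')\subsetneq\ell(\mathcal{M})$; $\mathcal{V}_2^*(T^\ell,j)$ is the set of minimal $2$-matchings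 of $T^\ell$ of size $j$. Each connected component of a $2$-matching $\mathcal{M}$ of $T^\ell$ is either a single loop $uu$ or a path of $T$. Orient each path component (in either direction) as $w_1w_2\cdots w_{m+1}$ and set its heads to be $\{w_2,\dots,w_{m+1}\}$ and tails $\{w_1,\dots,w_m\}$; a loop $uu$ has head and tail $u$. Let $h(\mathcal{M})$, $t(\mathcal{M})$ be the unions of heads and of tails over all components (each has $|\mathcal{M}|$ elements). Then $d(\mathcal{M},X)=\pm\det L(T,X)[h(\mathcal{M}),t(\mathcal{M})]$ (rows $h(\mathcal{M})$, columns $t(\mathcal{M})$), with the sign chosen so that the leading coefficient (with respect to the degree lexicographic monomial order) is positive. *)

theory Defs
  imports "HOL-Library.Poly_Mapping" "Jordan_Normal_Form.Determinant"
begin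

text \<open>Polynomials in Z[x_0, x_1, ...]: monomials are finitely supported exponent
  vectors nat \<Rightarrow>0 nat, polynomials are finitely supported coefficient maps.\<close>
type_synonym mpoly = "(nat \<Rightarrow>\<^sub>0 nat) \<Rightarrow>\<^sub>0 int"

definition Var :: "nat \<Rightarrow> mpoly" where
  "Var u = Poly_Mapping.single (Poly_Mapping.single u 1) 1"

text \<open>Ideal of a commutative ring generated by a set: all finite linear combinations.\<close>
definition ideal_gen :: "'a::comm_ring_1 set \<Rightarrow> 'a set" where
  "ideal_gen S = {p. \<exists>F c. finite F \<and> F \<subseteq> S \<and> p = (\<Sum>f\<in>F. c f * f)}"

text \<open>Graphs on the vertex set {0..<n}; edges are 2-element subsets.\<close>
definition adj_rel :: "nat set set \<Rightarrow> (nat \<times> nat) set" where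
  "adj_rel E = {(u, v). {u, v} \<in> E}"

definition is_tree :: "nat \<Rightarrow> nat set set \<Rightarrow> bool" where
  "is_tree n E \<longleftrightarrow>
     (\<forall>e\<in>E. \<exists>u v. u \<noteq> v \<and> u < n \<and> v < n \<and> e = {u, v}) \<and>
     (\<forall>u<n. \<forall>v<n. (u, v) \<in> (adj_rel E)\<^sup>*) \<and>
     \<not> (\<exists>vs. 3 \<le> length vs \<and> distinct vs \<and>
            (\<forall>i<length vs. {vs ! i, vs ! ((i + 1) mod length vs)} \<in> E))"

text \<open>Generalized Laplacian L(T,X) (simple graph, so m_uv \<in> {0,1}).\<close>
definition gen_laplacian :: "nat set set \<Rightarrow> nat \<Rightarrow> nat \<Rightarrow> mpoly" where
  "gen_laplacian E u v = (if u = v then Var u else if {u, v} \<in> E then -1 else 0)"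

text \<open>The minor with rows R and columns C (both in increasing order).\<close>
definition minor :: "nat set set \<Rightarrow> nat set \<Rightarrow> nat set \<Rightarrow> mpoly" where
  "minor E R C = det (mat (card R) (card C)
      (\<lambda>(a, b). gen_laplacian E (sorted_list_of_set R ! a) (sorted_list_of_set C ! b)))"

definition critical_ideal :: "nat \<Rightarrow> nat set set \<Rightarrow> nat \<Rightarrow> mpoly set" where
  "critical_ideal n E j = ideal_gen
     {minor E R C | R C. R \<subseteq> {0..<n} \<and> C \<subseteq> {0..<n} \<and> card R = j \<and> card C = j}"

text \<open>A 2-matching of T^l is a pair (F, Lp): F a set of tree edges, Lp the set of
  vertices carrying a loop in the matching; a loop counts twice for incidence.\<close>
definition is_two_matching :: "nat \<Rightarrow> nat set set \<Rightarrow> nat set set \<times> nat set \<Rightarrow> bool" where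
  "is_two_matching n E M \<longleftrightarrow> (case M of (F, Lp) \<Rightarrow>
     F \<subseteq> E \<and> Lp \<subseteq> {0..<n} \<and>
     (\<forall>v<n. card {e\<in>F. v \<in> e} + (if v \<in> Lp then 2 else 0) \<le> 2))"

definition two_matchings :: "nat \<Rightarrow> nat set set \<Rightarrow> nat \<Rightarrow> (nat set set \<times> nat set) set" where
  "two_matchings n E j = {(F, Lp). is_two_matching n E (F, Lp) \<and> card F + card Lp = j}"

definition min_two_matchings :: "nat \<Rightarrow> nat set set \<Rightarrow> nat \<Rightarrow> (nat set set \<times> nat set) set" where
  "min_two_matchings n E j = {(F, Lp). (F, Lp) \<in> two_matchings n E j \<and>
     \<not> (\<exists>F' Lp'. (F', Lp') \<in> two_matchings n E j \<and> Lp' \<subset> Lp)}"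

text \<open>An orientation of the path components of F: each edge {a,b} of F gets exactly one
  direction (a,b), and every vertex has in-degree and out-degree at most 1, i.e. every
  path component w_1...w_{m+1} is oriented as a directed path.\<close>
definition path_orientation :: "nat set set \<Rightarrow> (nat \<times> nat) set \<Rightarrow> bool" where
  "path_orientation F D \<longleftrightarrow>
     bij_betw (\<lambda>(a, b). {a, b}) D F \<and>
     (\<forall>v. card {a. (a, v) \<in> D} \<le> 1) \<and> (\<forall>v. card {b. (v, b) \<in> D} \<le> 1)"

definition heads :: "nat set \<Rightarrow> (nat \<times> nat) set \<Rightarrow> nat set" where
  "heads Lp D = {b. \<exists>a. (a, b) \<in> D} \<union> Lp"

definition tails :: "nat set \<Rightarrow> (nat \<times> nat) set \<Rightarrow> nat set" where
  "tails Lp D = {a. \<exists>b. (a, b) \<in> D} \<union> Lp"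

text \<open>Degree lexicographic order on monomials (total degree first, then the
  lexicographic order of Poly_Mapping, in which x_0 > x_1 > ...).\<close>
definition mono_deg :: "(nat \<Rightarrow>\<^sub>0 nat) \<Rightarrow> nat" where
  "mono_deg m = (\<Sum>k\<in>Poly_Mapping.keys m. Poly_Mapping.lookup m k)"

definition deglex_less :: "(nat \<Rightarrow>\<^sub>0 nat) \<Rightarrow> (nat \<Rightarrow>\<^sub>0 nat) \<Rightarrow> bool" where
  "deglex_less m1 m2 \<longleftrightarrow> mono_deg m1 < mono_deg m2 \<or> (mono_deg m1 = mono_deg m2 \<and> m1 < m2)"

definition lead_coeff_pos :: "mpoly \<Rightarrow> bool" where
  "lead_coeff_pos p \<longleftrightarrow> (\<exists>m. Poly_Mapping.lookup p m > 0 \<and> (\<forall>m'\<in>Poly_Mapping.keys p. m' \<noteq> m \<longrightarrow> deglex_less m' m))"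

definition sign_normalize :: "mpoly \<Rightarrow> mpoly" where
  "sign_normalize p = (if lead_coeff_pos p then p else - p)"

text \<open>d(M,X) for the 2-matching M = (F, Lp) with orientation D.\<close>
definition d_poly :: "nat set set \<Rightarrow> nat set \<Rightarrow> (nat \<times> nat) set \<Rightarrow> mpoly" where
  "d_poly E Lp D = sign_normalize (minor E (heads Lp D) (tails Lp D))"

end

theory Submission
  imports Defs
begin

text \<open>Only one property of trees matters: every edge is a bridge. Hence the disjoint paths that link
  the columns to the rows of a nonzero minor are forced, and the minor equals, up to sign, the
  principal minor on the set of loops of a 2-matching. Conversely let \<open>S\<close> be the loop set of a 2-matching
  of size \<open>j\<close> that is not minimal. Comparing it with a 2-matching of the same size with fewer loops, an
  exchange argument yields a vertex \<open>u\<close> in \<open>S\<close> and a 2-matching with one more edge whose loops are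
  \<open>S - {u}\<close>, in which \<open>u\<close> still has room for another edge. So \<open>S - {u}\<close> and, for each neighbour \<open>w\<close> of
  \<open>u\<close> in \<open>S\<close>, \<open>S - {u, w}\<close> are loop sets of size-\<open>j\<close> 2-matchings, and Laplace expansion along the row of
  \<open>u\<close> reduces the principal minor on \<open>S\<close> to theirs.\<close>

section \<open>Forests and augmentation\<close>

text \<open>The bridge property is stored as a cut: for an edge \<open>{u, v}\<close>, a set
  \<open>U\<close> containing \<open>u\<close> but not \<open>v\<close> that no other edge crosses.
  In this form it feeds directly into the descent to a leaf, the reversal of one side of an
  orientation, and the comparison of row and column counts in a determinant. Up to sign, the
  polynomial of a 2-matching depends only on its loop set \<open>S\<close>; edges and orientation
  merely certify that the principal minor on \<open>S\<close> represents a minor of size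
  \<open>j\<close>. The obstacle is to keep such a certificate while expanding. The diagonal term
  loses the loop at \<open>u\<close> and must gain one edge. The term of a neighbour
  \<open>w\<close> loses two loops and must gain two edges, and the second one is
  \<open>{u, w}\<close> itself. It fits only if \<open>w\<close> is free and \<open>u\<close> meets
  at most one edge, which is why \<open>augment\<close> delivers degree bounds on \<open>U\<close>
  besides the larger size.\<close>

definition forest :: "nat \<Rightarrow> nat set set \<Rightarrow> bool" where
  "forest n E \<longleftrightarrow> (\<forall>e\<in>E. \<exists>u v. u \<noteq> v \<and> u < n \<and> v < n \<and> e = {u, v}) \<and>
     (\<forall>u v. {u, v} \<in> E \<longrightarrow>
       (\<exists>U\<subseteq>{0..<n}. u \<in> U \<and> v \<notin> U \<and> (\<forall>a b. {a, b} \<in> E \<longrightarrow> a \<in> U \<longrightarrow> b \<notin> U \<longrightarrow> a = u \<and> b = v)))"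

text \<open>Loop erasure during the construction: if the new vertex already occurs, the walk is cut
  back to that occurrence.\<close>

lemma rtrancl_distinct_walk:
  assumes "(a, b) \<in> r\<^sup>*"
  shows "\<exists>vs. vs \<noteq> [] \<and> hd vs = a \<and> last vs = b \<and> distinct vs \<and>
    (\<forall>i. Suc i < length vs \<longrightarrow> (vs ! i, vs ! Suc i) \<in> r)"
  using assms
proof (induction rule: rtrancl_induct)
  case base
  show ?case by (rule exI[of _ "[a]"]) simp
next
  case (step b c)
  then obtain vs where vs: "vs \<noteq> []" "hd vs = a" "last vs = b" "distinct vs"
    "\<And>i. Suc i < length vs \<Longrightarrow> (vs ! i, vs ! Suc i) \<in> r" by blast
  show ?case
  proof (cases "c \<in> set vs")
    case True
    then obtain ys zs where s: "vs = ys @ c # zs" by (meson split_list)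
    show ?thesis
    proof (rule exI[of _ "ys @ [c]"], intro conjI allI impI)
      show "hd (ys @ [c]) = a" using vs(2) s by (cases ys) auto
      show "distinct (ys @ [c])" using vs(4) s by auto
      fix i assume "Suc i < length (ys @ [c])"
      then show "((ys @ [c]) ! i, (ys @ [c]) ! Suc i) \<in> r"
        using vs(5)[of i] s by (auto simp: nth_append split: if_splits)
    qed auto
  next
    case False
    show ?thesis
    proof (rule exI[of _ "vs @ [c]"], intro conjI allI impI)
      show "hd (vs @ [c]) = a" using vs by simp
      show "distinct (vs @ [c])" using vs False by auto
      fix i assume i: "Suc i < length (vs @ [c])"
      show "((vs @ [c]) ! i, (vs @ [c]) ! Suc i) \<in> r"
      proof (cases "Suc i < length vs")
        case True
        then show ?thesis using vs(5)[of i] by (simp add: nth_append)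
      next
        case False
        then have il: "Suc i = length vs" using i by simp
        then have "vs ! i = b" using vs(1,3) by (metis diff_Suc_1 last_conv_nth)
        then show ?thesis using step(2) il by (simp add: nth_append)
      qed
    qed auto
  qed
qed

text \<open>The cut of an edge \<open>{u, v}\<close> consists of the vertices reachable from
  \<open>u\<close> without that edge. If \<open>v\<close> were among them, a repetition-free walk
  from \<open>u\<close> to \<open>v\<close> together with the edge would be a cycle; it has at least
  three vertices because a walk on two would use the removed edge.\<close>

lemma tree_imp_forest:
  assumes "is_tree n E"
  shows "forest n E"
  unfolding forest_def
proof (intro conjI allI impI)
  show ends: "\<forall>e\<in>E. \<exists>u v. u \<noteq> v \<and> u < n \<and> v < n \<and> e = {u, v}"
    using assms unfolding is_tree_def by blast
  have nocyc: "\<not> (\<exists>vs. 3 \<le> length vs \<and> distinct vs \<and>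
            (\<forall>i<length vs. {vs ! i, vs ! ((i + 1) mod length vs)} \<in> E))"
    using assms unfolding is_tree_def by blast
  fix u v assume uv: "{u, v} \<in> E"
  then have une: "u \<noteq> v" "u < n" "v < n"
    using bspec[OF ends uv] by (auto simp: doubleton_eq_iff)
  define r where "r = {(a, b). {a, b} \<in> E \<and> {a, b} \<noteq> {u, v}}"
  have notr: "(u, v) \<notin> r\<^sup>*"
  proof
    assume "(u, v) \<in> r\<^sup>*"
    from rtrancl_distinct_walk[OF this] obtain vs where
      vs: "vs \<noteq> []" "hd vs = u" "last vs = v" "distinct vs"
      "\<And>i. Suc i < length vs \<Longrightarrow> (vs ! i, vs ! Suc i) \<in> r" by blast
    have l1: "length vs \<noteq> 1" using vs une by (auto simp: length_Suc_conv)
    have l2: "length vs \<noteq> 2"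
    proof
      assume l: "length vs = 2"
      then have "vs ! 0 = u" "vs ! 1 = v" using vs by (auto simp: hd_conv_nth last_conv_nth)
      then show False using vs(5)[of 0] l by (simp add: r_def)
    qed
    have l0: "length vs \<noteq> 0" using vs by simp
    have l3: "3 \<le> length vs" using l0 l1 l2 by linarith
    have "{vs ! i, vs ! ((i + 1) mod length vs)} \<in> E" if "i < length vs" for i
    proof (cases "Suc i < length vs")
      case True
      then show ?thesis using vs(5)[of i] by (simp add: r_def)
    next
      case False
      then have "Suc i = length vs" using that by simp
      then have "i = length vs - 1" "(i + 1) mod length vs = 0" by auto
      then have "vs ! i = v" "vs ! ((i + 1) mod length vs) = u"
        using vs(2,3) last_conv_nth[OF vs(1)] hd_conv_nth[OF vs(1)] by metis+
      then show ?thesis using uv by (simp add: insert_commute)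
    qed
    then show False using nocyc l3 vs(4) by blast
  qed
  show "\<exists>U\<subseteq>{0..<n}. u \<in> U \<and> v \<notin> U \<and>
      (\<forall>a b. {a, b} \<in> E \<longrightarrow> a \<in> U \<longrightarrow> b \<notin> U \<longrightarrow> a = u \<and> b = v)"
  proof (rule exI[of _ "{x. (u, x) \<in> r\<^sup>* \<and> x < n}"], intro conjI allI impI)
    show "{x. (u, x) \<in> r\<^sup>* \<and> x < n} \<subseteq> {0..<n}" by auto
    show "u \<in> {x. (u, x) \<in> r\<^sup>* \<and> x < n}" using une by simp
    show "v \<notin> {x. (u, x) \<in> r\<^sup>* \<and> x < n}" using notr by simp
    fix a b
    assume ab: "{a, b} \<in> E" "a \<in> {x. (u, x) \<in> r\<^sup>* \<and> x < n}" "b \<notin> {x. (u, x) \<in> r\<^sup>* \<and> x < n}"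
    have "b < n" using bspec[OF ends ab(1)] by (auto simp: doubleton_eq_iff)
    then have "(u, b) \<notin> r\<^sup>*" using ab by simp
    then have "(a, b) \<notin> r" using ab by (auto intro: rtrancl_into_rtrancl)
    then have "{a, b} = {u, v}" using ab by (simp add: r_def)
    moreover have "a \<noteq> v" using ab notr by auto
    ultimately show "a = u" "b = v" by (auto simp: doubleton_eq_iff)
  qed
qed

lemma forest_edgeE:
  assumes "forest n E" "e \<in> E"
  obtains u v where "u \<noteq> v" "u < n" "v < n" "e = {u, v}"
proof -
  have "\<forall>e\<in>E. \<exists>u v. u \<noteq> v \<and> u < n \<and> v < n \<and> e = {u, v}"
    using assms(1) unfolding forest_def by (rule conjunct1)
  then show thesis using that assms(2) by meson
qed

lemma forest_edgeD:
  assumes "forest n E" "{u, v} \<in> E"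
  shows "u \<noteq> v" "u < n" "v < n"
proof -
  obtain a b where "a \<noteq> b" "a < n" "b < n" "{u, v} = {a, b}"
    using forest_edgeE[OF assms] by blast
  then show "u \<noteq> v" "u < n" "v < n" by (auto simp: doubleton_eq_iff)
qed

lemma forest_cutE:
  assumes "forest n E" "{u, v} \<in> E"
  obtains U where "U \<subseteq> {0..<n}" "u \<in> U" "v \<notin> U"
    "\<And>a b. {a, b} \<in> E \<Longrightarrow> a \<in> U \<Longrightarrow> b \<notin> U \<Longrightarrow> a = u \<and> b = v"
proof -
  have "\<forall>u v. {u, v} \<in> E \<longrightarrow> (\<exists>U\<subseteq>{0..<n}. u \<in> U \<and> v \<notin> U \<and>
      (\<forall>a b. {a, b} \<in> E \<longrightarrow> a \<in> U \<longrightarrow> b \<notin> U \<longrightarrow> a = u \<and> b = v))"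
    using assms(1) unfolding forest_def by (rule conjunct2)
  then obtain U where "U \<subseteq> {0..<n}" "u \<in> U" "v \<notin> U"
      "\<forall>a b. {a, b} \<in> E \<longrightarrow> a \<in> U \<longrightarrow> b \<notin> U \<longrightarrow> a = u \<and> b = v"
    using assms(2) by meson
  then show thesis by (intro that[of U]) simp_all
qed

lemma forest_finite:
  assumes "forest n E"
  shows "finite E"
proof (rule finite_subset)
  show "E \<subseteq> Pow {0..<n}"
  proof
    fix e assume "e \<in> E"
    then obtain u v where "u < n" "v < n" "e = {u, v}" using forest_edgeE[OF assms] by metis
    then show "e \<in> Pow {0..<n}" by auto
  qed
qed simp

section \<open>Edge degrees and leaves\<close>

definition edge_degree :: "'a set set \<Rightarrow> 'a \<Rightarrow> nat" where
  "edge_degree F v = card {e \<in> F. v \<in> e}"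

lemma edge_degree_insert:
  assumes "finite F" "e \<notin> F"
  shows "edge_degree (insert e F) v = edge_degree F v + (if v \<in> e then 1 else 0)"
proof -
  have "{x \<in> insert e F. v \<in> x} = (if v \<in> e then insert e {x \<in> F. v \<in> x} else {x \<in> F. v \<in> x})" by auto
  then show ?thesis using assms by (simp add: edge_degree_def)
qed

lemma edge_degree_Diff1:
  assumes "finite F" "e \<in> F"
  shows "edge_degree (F - {e}) v = edge_degree F v - (if v \<in> e then 1 else 0)"
proof -
  have "insert e (F - {e}) = F" using assms by blast
  then show ?thesis using edge_degree_insert[of "F - {e}" e v] assms by simp
qed

lemma edge_degree_Un_disjoint:
  assumes "finite F" "finite G" "F \<inter> G = {}"
  shows "edge_degree (F \<union> G) v = edge_degree F v + edge_degree G v"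
proof -
  have "{e \<in> F \<union> G. v \<in> e} = {e \<in> F. v \<in> e} \<union> {e \<in> G. v \<in> e}" by auto
  moreover have "card ({e \<in> F. v \<in> e} \<union> {e \<in> G. v \<in> e}) = card {e \<in> F. v \<in> e} + card {e \<in> G. v \<in> e}"
    using assms by (intro card_Un_disjoint) auto
  ultimately show ?thesis unfolding edge_degree_def by simp
qed

lemma edge_degree_eq_0_iff: "finite F \<Longrightarrow> edge_degree F v = 0 \<longleftrightarrow> (\<forall>e\<in>F. v \<notin> e)"
  by (auto simp: edge_degree_def)

lemma edge_degree_le_1_unique:
  assumes "finite F" "edge_degree F v \<le> 1" "e \<in> F" "v \<in> e" "e' \<in> F" "v \<in> e'"
  shows "e = e'"
  using assms card_le_Suc0_iff_eq[of "{e \<in> F. v \<in> e}"] unfolding edge_degree_def by auto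

lemma handshake:
  assumes "forest n E" "F \<subseteq> E"
  shows "(\<Sum>v<n. edge_degree F v) = 2 * card F"
proof -
  have fin: "finite F" using assms forest_finite finite_subset by blast
  have "(\<Sum>v<n. edge_degree F v) = (\<Sum>v<n. \<Sum>e\<in>F. if v \<in> e then 1 else 0)"
    unfolding edge_degree_def using fin by (intro sum.cong) (simp_all add: sum.inter_filter[symmetric])
  also have "\<dots> = (\<Sum>e\<in>F. \<Sum>v<n. if v \<in> e then 1 else 0)" by (rule sum.swap)
  also have "\<dots> = (\<Sum>e\<in>F. 2)"
  proof (rule sum.cong[OF refl])
    fix e assume "e \<in> F"
    then obtain u v where uv: "u \<noteq> v" "u < n" "v < n" "e = {u, v}"
      using assms forest_edgeE by blast
    then have "{x \<in> {..<n}. x \<in> e} = {u, v}" by auto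
    then have "card {x \<in> {..<n}. x \<in> e} = 2" using uv by simp
    then show "(\<Sum>v<n. if v \<in> e then 1 else 0 :: nat) = 2"
      by (simp add: sum.inter_filter[symmetric])
  qed
  finally show ?thesis by simp
qed

text \<open>Descent on the side \<open>U\<close>. If \<open>u\<close> is not a leaf of
  \<open>H\<close>, a second edge of \<open>H\<close> leads from \<open>u\<close> to some
  \<open>w\<close>, which stays in \<open>U\<close> because only \<open>{u, v}\<close> leaves
  \<open>U\<close>. The cut of \<open>{w, u}\<close> on the side of \<open>w\<close>, intersected
  with \<open>U\<close>, omits \<open>u\<close> and is therefore smaller.\<close>

lemma forest_leaf_in_cut:
  assumes f: "forest n E" and H: "H \<subseteq> E"
  shows "U \<subseteq> {0..<n} \<Longrightarrow> {u, v} \<in> H \<Longrightarrow> u \<in> U \<Longrightarrow> v \<notin> U \<Longrightarrow>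
    (\<And>a b. {a, b} \<in> E \<Longrightarrow> a \<in> U \<Longrightarrow> b \<notin> U \<Longrightarrow> a = u \<and> b = v) \<Longrightarrow> \<exists>x<n. edge_degree H x = 1"
proof (induction "card U" arbitrary: U u v rule: less_induct)
  case less
  have fin: "finite H" using f H forest_finite finite_subset by blast
  show ?case
  proof (cases "edge_degree H u = 1")
    case True
    moreover have "u < n" using less.prems(1,3) by auto
    ultimately show ?thesis by blast
  next
    case False
    have "{e \<in> H. u \<in> e} \<noteq> {{u, v}}"
    proof
      assume "{e \<in> H. u \<in> e} = {{u, v}}"
      then show False using False by (simp add: edge_degree_def)
    qed
    moreover have "{u, v} \<in> {e \<in> H. u \<in> e}" using less.prems(2) by simp
    ultimately obtain e where e: "e \<in> H" "u \<in> e" "e \<noteq> {u, v}" by blast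
    obtain w where w: "e = {w, u}"
    proof -
      have "e \<in> E" using e(1) H by blast
      then obtain x y where "e = {x, y}" using forest_edgeE[OF f] by metis
      then show ?thesis using that e(2) by (auto simp: insert_commute)
    qed
    have wu: "{w, u} \<in> E" "{u, w} \<in> E" using e w H by (auto simp: insert_commute)
    have wU: "w \<in> U" using less.prems(5)[of u w] less.prems(3) wu e(3) w by (auto simp: insert_commute)
    obtain W where W: "W \<subseteq> {0..<n}" "w \<in> W" "u \<notin> W"
      "\<And>a b. {a, b} \<in> E \<Longrightarrow> a \<in> W \<Longrightarrow> b \<notin> W \<Longrightarrow> a = w \<and> b = u"
      using forest_cutE[OF f wu(1)] by metis
    have "card (W \<inter> U) < card U"
      using less.prems(1,3) W(3) by (intro psubset_card_mono) (auto intro: finite_subset)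
    \<comment> \<open>An edge leaving the intersection by leaving \<open>U\<close> would have to
      start in \<open>u\<close>, which is not in \<open>W\<close>; so it leaves
      \<open>W\<close>.\<close>
    moreover have "a = w \<and> b = u" if "{a, b} \<in> E" "a \<in> W \<inter> U" "b \<notin> W \<inter> U" for a b
      using that W less.prems(5)[of a b] by blast
    ultimately show ?thesis
      using less.hyps[of "W \<inter> U" w u] e w W wU by blast
  qed
qed

lemma forest_has_leaf:
  assumes "forest n E" "H \<subseteq> E" "H \<noteq> {}"
  shows "\<exists>x<n. edge_degree H x = 1"
proof -
  obtain e where e: "e \<in> H" using assms by blast
  then have "e \<in> E" using assms(2) by blast
  then obtain u v where uv: "e = {u, v}" using forest_edgeE[OF assms(1)] by metis
  obtain U where "U \<subseteq> {0..<n}" "u \<in> U" "v \<notin> U"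
    "\<And>a b. {a, b} \<in> E \<Longrightarrow> a \<in> U \<Longrightarrow> b \<notin> U \<Longrightarrow> a = u \<and> b = v"
    using forest_cutE[OF assms(1), of u v] \<open>e \<in> E\<close> uv by metis
  then show ?thesis using forest_leaf_in_cut[OF assms(1,2), of U u v] e uv by blast
qed

section \<open>Augmenting a 2-matching\<close>

text \<open>Exchanging edges one by one makes \<open>F'\<close> and \<open>F\<close> agree as far as possible. If no
  augmentation shows up on the way, every endpoint of an edge of \<open>F' - F\<close> lies in \<open>U\<close> or is
  saturated by \<open>F\<close>; counting degrees, the symmetric difference then has no leaf.\<close>

lemma augment:
  assumes f: "forest n E" and F: "F \<subseteq> E" "\<And>v. edge_degree F v \<le> 2"
    and F': "F' \<subseteq> E" "\<And>v. edge_degree F' v \<le> 2"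
    and U: "U \<subseteq> {..<n}" "U \<noteq> {}" "\<And>u. u \<in> U \<Longrightarrow> edge_degree F u = 0"
    and c: "card F' = card F + card U"
  shows "\<exists>u\<in>U. \<exists>G\<subseteq>F \<union> F'. card G = Suc (card F) \<and> (\<forall>v. edge_degree G v \<le> 2) \<and>
    (\<forall>v\<in>U - {u}. edge_degree G v = 0) \<and> edge_degree G u \<le> 1"
  using F U(3) c
proof (induction "card (F' - F)" arbitrary: F rule: less_induct)
  case less
  have finE: "finite E" using f forest_finite by blast
  have fF: "finite F" and fF': "finite F'" and fU: "finite U"
    using less.prems(1) F'(1) finE U(1) by (auto intro: finite_subset)
  let ?thesis' = "\<exists>u\<in>U. \<exists>G\<subseteq>F \<union> F'. card G = Suc (card F) \<and> (\<forall>v. edge_degree G v \<le> 2) \<and>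
    (\<forall>v\<in>U - {u}. edge_degree G v = 0) \<and> edge_degree G u \<le> 1"
  have key: "a \<in> U \<or> edge_degree F a = 2" if no: "\<not> ?thesis'" and e: "e \<in> F' - F" "a \<in> e" for e a
  proof (rule ccontr)
    assume "\<not> (a \<in> U \<or> edge_degree F a = 2)"
    then have a: "a \<notin> U" "edge_degree F a \<le> 1" using less.prems(2)[of a] by auto
    obtain b where b: "a \<noteq> b" "e = {a, b}" 
    proof -
      have "e \<in> E" using F'(1) e by blast
      then obtain x y where "x \<noteq> y" "e = {x, y}" using forest_edgeE[OF f] by metis
      then show ?thesis using that[of x] that[of y] e(2) by (auto simp: insert_commute)
    qed
    have ins: "edge_degree (insert e F) v = edge_degree F v + (if v \<in> e then 1 else 0)" for v
      using edge_degree_insert[OF fF, of e v] e(1) by simp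
    have cins: "card (insert e F) = Suc (card F)" "insert e F \<subseteq> F \<union> F'" using e fF by auto
    show False
    proof (cases "edge_degree F b \<le> 1")
      case True
      \<comment> \<open>Only \<open>u\<close> may have positive degree among the vertices of
        \<open>U\<close>, so it must be \<open>b\<close> if \<open>b\<close> lies in
        \<open>U\<close>; otherwise any element of \<open>U\<close> will do.\<close>
      obtain u where u: "u \<in> U" "b \<in> U \<longrightarrow> u = b" using U(2) by blast
      have "\<forall>v. edge_degree (insert e F) v \<le> 2"
        using ins b a True less.prems(2) by auto
      moreover have "\<forall>v\<in>U - {u}. edge_degree (insert e F) v = 0" "edge_degree (insert e F) u \<le> 1"
        using ins b a u less.prems(3) by auto
      ultimately show False using no u cins by blast
    next
      case False
      then have b2: "edge_degree F b = 2" using less.prems(2)[of b] by simp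
      then have bU: "b \<notin> U" using less.prems(3)[of b] by auto
      \<comment> \<open>If both edges of \<open>F\<close> at \<open>b\<close> belonged to
        \<open>F'\<close>, then together with \<open>e\<close> they would give \<open>b\<close>
        degree 3 in \<open>F'\<close>.\<close>
      have "\<exists>g\<in>F - F'. b \<in> g"
      proof (rule ccontr)
        assume "\<not> (\<exists>g\<in>F - F'. b \<in> g)"
        then have "insert e {g\<in>F. b \<in> g} \<subseteq> {g\<in>F'. b \<in> g}" using e b by auto
        then have "card (insert e {g\<in>F. b \<in> g}) \<le> edge_degree F' b"
          unfolding edge_degree_def using fF' by (intro card_mono) auto
        then have "3 \<le> edge_degree F' b" using b2 fF e(1) by (simp add: edge_degree_def)
        then show False using F'(2)[of b] by simp
      qed
      then obtain g where g: "g \<in> F" "g \<notin> F'" "b \<in> g" by blast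
      \<comment> \<open>Trading \<open>g\<close> for \<open>e\<close> keeps the size and the degree
        of \<open>b\<close>, raises \<open>a\<close> to at most 2 and does not touch
        \<open>U\<close>. It brings \<open>F\<close> closer to \<open>F'\<close>, since
        \<open>e\<close> lies in \<open>F'\<close> and \<open>g\<close> does not.\<close>
      define F2 where "F2 = insert e (F - {g})"
      have F2deg: "edge_degree F2 v = edge_degree F v - (if v \<in> g then 1 else 0) + (if v \<in> e then 1 else 0)" for v
        unfolding F2_def using fF g e
        by (subst edge_degree_insert) (auto simp: edge_degree_Diff1)
      have F2c: "card F2 = card F" unfolding F2_def using fF g e card_Suc_Diff1[of F g] by simp
      have lt: "card (F' - F2) < card (F' - F)"
        unfolding F2_def using fF' g e by (intro psubset_card_mono) auto
      have "\<exists>u\<in>U. \<exists>G\<subseteq>F2 \<union> F'. card G = Suc (card F2) \<and> (\<forall>v. edge_degree G v \<le> 2) \<and>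
          (\<forall>v\<in>U - {u}. edge_degree G v = 0) \<and> edge_degree G u \<le> 1"
      proof (rule less.hyps[OF lt])
        show "F2 \<subseteq> E" using F2_def less.prems(1) F'(1) e by auto
        show "edge_degree F2 v \<le> 2" for v
        proof -
          have "edge_degree F v \<le> 2" by (rule less.prems(2))
          then show ?thesis unfolding F2deg using a b b2 g(3) by auto
        qed
        show "edge_degree F2 u = 0" if "u \<in> U" for u
          unfolding F2deg using that less.prems(3)[OF that] a bU b by auto
        show "card F' = card F2 + card U" using F2c less.prems(4) by simp
      qed
      moreover have "F2 \<union> F' \<subseteq> F \<union> F'" using F2_def e by auto
      ultimately have ?thesis' unfolding F2c by (meson order_trans)
      then show False using no by contradiction
    qed
  qed
  show ?case
  proof (rule ccontr)
    assume no: "\<not> ?thesis'"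
    define K N where "K = F' - F" and "N = F - F'"
    have fKN: "finite K" "finite N" using fF fF' by (auto simp: K_def N_def)
    have KI: "edge_degree F' v = edge_degree K v + edge_degree (F \<inter> F') v" 
      "edge_degree F v = edge_degree N v + edge_degree (F \<inter> F') v" for v
    proof -
      have "F' = K \<union> (F \<inter> F')" "F = N \<union> (F \<inter> F')" by (auto simp: K_def N_def)
      moreover have "K \<inter> (F \<inter> F') = {}" "N \<inter> (F \<inter> F') = {}" by (auto simp: K_def N_def)
      ultimately show "edge_degree F' v = edge_degree K v + edge_degree (F \<inter> F') v" 
        "edge_degree F v = edge_degree N v + edge_degree (F \<inter> F') v"
        using edge_degree_Un_disjoint[of K "F \<inter> F'" v] edge_degree_Un_disjoint[of N "F \<inter> F'" v] fKN fF
        by simp_all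
    qed
    \<comment> \<open>Outside \<open>U\<close>, a vertex met by \<open>K\<close> is saturated by
      \<open>F\<close>, so its degree in \<open>F'\<close> is no larger than in \<open>F\<close>;
      the common edges cancel. Inside \<open>U\<close> the bound 2 on \<open>F'\<close>
      suffices.\<close>
    have le: "edge_degree K v \<le> edge_degree N v + (if v \<in> U then 2 else 0)" for v
    proof (cases "edge_degree K v = 0")
      case False
      then obtain e where "e \<in> K" "v \<in> e" using fKN by (auto simp: edge_degree_eq_0_iff)
      then have "v \<in> U \<or> edge_degree F v = 2" using key[OF no, of e v] by (auto simp: K_def)
      then show ?thesis using KI[of v] F'(2)[of v] by auto
    qed simp
    have "card F' = card K + card (F \<inter> F')" "card F = card N + card (F \<inter> F')"
      unfolding K_def N_def using fF fF' 
      by (metis add.commute card_Int_Diff inf_commute)+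
    then have "card K = card N + card U" using less.prems(4) by simp
    moreover have "(\<Sum>v<n. edge_degree K v) = 2 * card K" "(\<Sum>v<n. edge_degree N v) = 2 * card N"
      using handshake[OF f] less.prems(1) F'(1) unfolding K_def N_def by blast+
    moreover have "(\<Sum>v<n. if v \<in> U then 2 else 0) = 2 * card U"
    proof -
      have "{v \<in> {..<n}. v \<in> U} = U" using U(1) by auto
      then show ?thesis by (simp add: sum.inter_filter[symmetric])
    qed
    ultimately have "(\<Sum>v<n. edge_degree K v) = (\<Sum>v<n. edge_degree N v + (if v \<in> U then 2 else 0))"
      by (simp add: sum.distrib)
    \<comment> \<open>With equal sums the pointwise inequality \<open>le\<close> is an equality.
      Hence all degrees in \<open>K \<union> N\<close> are even, while a leaf has degree 1.\<close>
    then have eq: "edge_degree K v = edge_degree N v + (if v \<in> U then 2 else 0)" if "v < n" for v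
      using sum_mono_inv[of "edge_degree K" "{..<n}" "\<lambda>v. edge_degree N v + (if v \<in> U then 2 else 0)" v] le that by simp
    have "K \<noteq> {}" using \<open>card K = card N + card U\<close> U(2) fU by auto
    then obtain x where x: "x < n" "edge_degree (K \<union> N) x = 1"
      using forest_has_leaf[OF f, of "K \<union> N"] less.prems(1) F'(1) by (auto simp: K_def N_def)
    have "edge_degree (K \<union> N) x = edge_degree K x + edge_degree N x"
      using fKN by (intro edge_degree_Un_disjoint) (auto simp: K_def N_def)
    then have "even (edge_degree (K \<union> N) x)" using eq[OF x(1)] by simp
    then show False using x by simp
  qed
qed

section \<open>Orientations of 2-matchings\<close>

text \<open>A form of \<open>path_orientation\<close> by membership instead of a bijection and
  cardinalities; for edge sets in a forest the two are equivalent. Asymmetry stands for injectivity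
  of the map from arcs to edges.\<close>

definition orients :: "'a set set \<Rightarrow> ('a \<times> 'a) set \<Rightarrow> bool" where
  "orients F D \<longleftrightarrow> (\<forall>a b. {a, b} \<in> F \<longleftrightarrow> (a, b) \<in> D \<or> (b, a) \<in> D) \<and> asym D \<and>
     single_valued D \<and> single_valued (D\<inverse>)"

lemma orientsD:
  assumes "orients F D"
  shows "{a, b} \<in> F \<longleftrightarrow> (a, b) \<in> D \<or> (b, a) \<in> D" "(a, b) \<in> D \<Longrightarrow> (b, a) \<notin> D"
    "(a, b) \<in> D \<Longrightarrow> (a, c) \<in> D \<Longrightarrow> b = c" "(b, a) \<in> D \<Longrightarrow> (c, a) \<in> D \<Longrightarrow> b = c"
proof -
  have D: "\<forall>a b. {a, b} \<in> F \<longleftrightarrow> (a, b) \<in> D \<or> (b, a) \<in> D" "asym D" "single_valued D" "single_valued (D\<inverse>)"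
    using assms unfolding orients_def by simp_all
  show "{a, b} \<in> F \<longleftrightarrow> (a, b) \<in> D \<or> (b, a) \<in> D" using D(1) by simp
  show "(a, b) \<in> D \<Longrightarrow> (b, a) \<notin> D" using D(2) by (rule asymD)
  show "(a, b) \<in> D \<Longrightarrow> (a, c) \<in> D \<Longrightarrow> b = c" using D(3) by (rule single_valuedD)
  show "(b, a) \<in> D \<Longrightarrow> (c, a) \<in> D \<Longrightarrow> b = c" using single_valuedD[OF D(4), of a b c] by simp
qed

lemma orientsI:
  assumes "\<And>a b. {a, b} \<in> F \<longleftrightarrow> (a, b) \<in> D \<or> (b, a) \<in> D" "\<And>a b. (a, b) \<in> D \<Longrightarrow> (b, a) \<notin> D"
    "\<And>a b c. (a, b) \<in> D \<Longrightarrow> (a, c) \<in> D \<Longrightarrow> b = c" "\<And>a b c. (b, a) \<in> D \<Longrightarrow> (c, a) \<in> D \<Longrightarrow> b = c"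
  shows "orients F D"
  unfolding orients_def
proof (intro conjI allI)
  show "asym D" using assms(2) by (rule asymI)
  show "single_valued D" by (rule single_valuedI) (rule assms(3))
  show "single_valued (D\<inverse>)" by (rule single_valuedI) (auto dest: assms(4))
qed (rule assms(1))

text \<open>Since no edge of \<open>F\<close> leaves \<open>A\<close>, at each vertex either all
  arcs are reversed or none. Reversal only exchanges the in-arc and the out-arc there.\<close>

lemma orients_flip:
  assumes D: "orients F D" and A: "\<And>a b. {a, b} \<in> F \<Longrightarrow> a \<in> A \<longleftrightarrow> b \<in> A"
  shows "orients F {(a, b). if a \<in> A then (b, a) \<in> D else (a, b) \<in> D}"
proof -
  have s: "a \<in> A \<longleftrightarrow> b \<in> A" if "(a, b) \<in> D" for a b
    using A[of a b] orientsD(1)[OF D, of a b] that by simp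
  have s': "(a, b) \<in> D \<Longrightarrow> a \<in> A \<Longrightarrow> b \<in> A" "(a, b) \<in> D \<Longrightarrow> b \<in> A \<Longrightarrow> a \<in> A" for a b
    using s by metis+
  show ?thesis
  proof (rule orientsI)
    fix a b c
    show "{a, b} \<in> F \<longleftrightarrow> (a, b) \<in> {(a, b). if a \<in> A then (b, a) \<in> D else (a, b) \<in> D} \<or>
      (b, a) \<in> {(a, b). if a \<in> A then (b, a) \<in> D else (a, b) \<in> D}"
      using orientsD(1)[OF D, of a b] s[of a b] s[of b a] by (simp split: if_split) metis
    show "(b, a) \<notin> {(a, b). if a \<in> A then (b, a) \<in> D else (a, b) \<in> D}"
      if "(a, b) \<in> {(a, b). if a \<in> A then (b, a) \<in> D else (a, b) \<in> D}"
      using that unfolding mem_Collect_eq case_prod_conv by (metis s' orientsD(2)[OF D])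
    show "b = c" if "(a, b) \<in> {(a, b). if a \<in> A then (b, a) \<in> D else (a, b) \<in> D}"
      "(a, c) \<in> {(a, b). if a \<in> A then (b, a) \<in> D else (a, b) \<in> D}"
      using that unfolding mem_Collect_eq case_prod_conv by (metis orientsD(3,4)[OF D])
    show "b = c" if "(b, a) \<in> {(a, b). if a \<in> A then (b, a) \<in> D else (a, b) \<in> D}"
      "(c, a) \<in> {(a, b). if a \<in> A then (b, a) \<in> D else (a, b) \<in> D}"
      using that unfolding mem_Collect_eq case_prod_conv by (metis s' orientsD(3,4)[OF D])
  qed
qed

text \<open>A new edge joins two ends of path components; reversing all arcs on one side of the cut
  given by the edge makes their directions match.\<close>

lemma forest_orients_exists:
  assumes f: "forest n E" and "F \<subseteq> E" "\<And>v. edge_degree F v \<le> 2"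
  shows "\<exists>D. orients F D"
proof -
  have "finite F" using assms(1,2) forest_finite finite_subset by metis
  then show ?thesis using assms(2,3)
  proof (induction F rule: finite_induct)
    case empty
    have "orients {} ({} :: (nat \<times> nat) set)" by (rule orientsI) simp_all
    then show ?case by blast
  next
    case (insert e F)
    have deg: "edge_degree F w \<le> (if w \<in> e then 1 else 2)" for w
      using insert.prems(2)[of w] edge_degree_insert[OF insert.hyps, of w] by (auto split: if_splits)
    have "F \<subseteq> E" "e \<in> E" using insert.prems(1) by auto
    have "edge_degree F w \<le> 2" for w using deg[of w] by (auto split: if_splits)
    then obtain D where D: "orients F D" using insert.IH[OF \<open>F \<subseteq> E\<close>] by metis
    obtain u v where uv: "u \<noteq> v" "e = {u, v}" using forest_edgeE[OF f \<open>e \<in> E\<close>] by metis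
    obtain U where U: "u \<in> U" "v \<notin> U"
      "\<And>a b. {a, b} \<in> E \<Longrightarrow> a \<in> U \<Longrightarrow> b \<notin> U \<Longrightarrow> a = u \<and> b = v"
      using forest_cutE[OF f, of u v] \<open>e \<in> E\<close> uv by metis
    have side: "a \<in> U \<longleftrightarrow> b \<in> U" if "{a, b} \<in> F" for a b
    proof -
      have "{a, b} \<noteq> {u, v}" using that uv insert.hyps(2) by metis
      moreover have "{a, b} \<in> E" "{b, a} \<in> E" using that \<open>F \<subseteq> E\<close> by (auto simp: insert_commute)
      ultimately show ?thesis using U(3)[of a b] U(3)[of b a] by (metis insert_commute)
    qed
    \<comment> \<open>An endpoint of the new edge meets at most one edge of \<open>F\<close>, so it
      cannot have both an in-arc and an out-arc.\<close>
    have one_end: "\<not> ((w, x) \<in> D' \<and> (y, w) \<in> D')" if "w \<in> e" "orients F D'" for w x y D'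
    proof
      assume xy: "(w, x) \<in> D' \<and> (y, w) \<in> D'"
      then have "{w, x} \<in> F" "{w, y} \<in> F" using orientsD(1)[OF that(2)] by metis+
      moreover have "edge_degree F w \<le> 1" using deg[of w] that(1) by simp
      ultimately have "{w, x} = {w, y}"
        using edge_degree_le_1_unique[OF insert.hyps(1), of w "{w, x}" "{w, y}"] by simp
      then have "x = y" by (auto simp: doubleton_eq_iff)
      then show False using xy orientsD(2)[OF that(2)] by metis
    qed
    \<comment> \<open>The new arc will run from \<open>u\<close> to \<open>v\<close>, so
      \<open>u\<close> must have no out-arc. If it has one, it has no in-arc, and reversing the side
      \<open>U\<close> repairs this.\<close>
    have "\<exists>D1. orients F D1 \<and> (\<forall>x. (u, x) \<notin> D1)"
    proof (cases "\<exists>x. (u, x) \<in> D")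
      case True
      let ?D = "{(a, b). if a \<in> U then (b, a) \<in> D else (a, b) \<in> D}"
      have "(u, y) \<notin> ?D" for y using True one_end[of u D _ y] D uv(2) U(1) by auto
      moreover have "orients F ?D" by (rule orients_flip[OF D side])
      ultimately show ?thesis by (intro exI[of _ ?D] conjI allI)
    next
      case False
      then show ?thesis using D by metis
    qed
    then obtain D1 where D1: "orients F D1" "\<And>x. (u, x) \<notin> D1" by metis
    \<comment> \<open>The same for in-arcs at \<open>v\<close>, now reversing the complement of
      \<open>U\<close>, so that the arcs at \<open>u\<close> stay as arranged.\<close>
    have "\<exists>D2. orients F D2 \<and> (\<forall>x. (u, x) \<notin> D2) \<and> (\<forall>x. (x, v) \<notin> D2)"
    proof (cases "\<exists>x. (x, v) \<in> D1")
      case True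
      let ?D = "{(a, b). if a \<in> - U then (b, a) \<in> D1 else (a, b) \<in> D1}"
      have o: "orients F ?D" by (rule orients_flip[OF D1(1)]) (use side in auto)
      moreover have "(u, y) \<notin> ?D" for y using D1(2) U(1) by simp
      moreover have "(y, v) \<notin> ?D" for y
      proof
        assume y: "(y, v) \<in> ?D"
        have "{y, v} \<in> F" by (rule iffD2[OF orientsD(1)[OF o], OF disjI1[OF y]])
        then have "y \<notin> U" using side[of y v] U(2) by simp
        then have "(v, y) \<in> D1" using y by simp
        moreover obtain x where "(x, v) \<in> D1" using True by blast
        moreover have "v \<in> e" using uv(2) by simp
        ultimately show False using one_end[OF _ D1(1)] by metis
      qed
      ultimately show ?thesis by (intro exI[of _ ?D] conjI allI)
    next
      case False
      then show ?thesis using D1 by metis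
    qed
    then obtain D2 where D2: "orients F D2" "\<And>x. (u, x) \<notin> D2" "\<And>x. (x, v) \<notin> D2" by metis
    have "orients (insert e F) (insert (u, v) D2)"
    proof (rule orientsI)
      fix a b c
      show "{a, b} \<in> insert e F \<longleftrightarrow> (a, b) \<in> insert (u, v) D2 \<or> (b, a) \<in> insert (u, v) D2"
        using orientsD(1)[OF D2(1), of a b] uv(2) by (auto simp: doubleton_eq_iff)
      show "(b, a) \<notin> insert (u, v) D2" if "(a, b) \<in> insert (u, v) D2"
        using that orientsD(2)[OF D2(1), of a b] orientsD(2)[OF D2(1), of b a] uv
          orientsD(1)[OF D2(1), of u v] insert.hyps(2) by auto
      show "b = c" if "(a, b) \<in> insert (u, v) D2" "(a, c) \<in> insert (u, v) D2"
        using that D2(2) unfolding insert_iff prod.inject by (metis orientsD(3)[OF D2(1)])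
      show "b = c" if "(b, a) \<in> insert (u, v) D2" "(c, a) \<in> insert (u, v) D2"
        using that D2(3) unfolding insert_iff prod.inject by (metis orientsD(4)[OF D2(1)])
    qed
    then show ?case by metis
  qed
qed

lemma orients_bij_betw:
  assumes o: "orients F D" and F: "\<And>e. e \<in> F \<Longrightarrow> \<exists>a b. e = {a, b}"
  shows "bij_betw (\<lambda>(a, b). {a, b}) D F"
  unfolding bij_betw_def
proof (intro conjI equalityI subsetI)
  show "inj_on (\<lambda>(a, b). {a, b}) D"
  proof (rule inj_onI)
    fix x y assume xy: "x \<in> D" "y \<in> D" "(case x of (a, b) \<Rightarrow> {a, b}) = (case y of (a, b) \<Rightarrow> {a, b})"
    obtain a b c d where "x = (a, b)" "y = (c, d)" by (metis prod.exhaust)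
    then show "x = y" using xy orientsD(2)[OF o, of a b] by (auto simp: doubleton_eq_iff)
  qed
  fix e assume "e \<in> (\<lambda>(a, b). {a, b}) ` D"
  then obtain a b where "(a, b) \<in> D" "e = {a, b}" by auto
  then show "e \<in> F" using orientsD(1)[OF o, of a b] by simp
next
  fix e assume e: "e \<in> F"
  then obtain a b where ab: "e = {a, b}" using F by metis
  then have "(a, b) \<in> D \<or> (b, a) \<in> D" using orientsD(1)[OF o, of a b] e by simp
  then show "e \<in> (\<lambda>(a, b). {a, b}) ` D"
  proof
    assume "(b, a) \<in> D"
    then show ?thesis using ab by (intro rev_image_eqI[of "(b, a)"]) (simp_all add: insert_commute)
  qed (use ab in \<open>intro rev_image_eqI[of "(a, b)"], simp_all\<close>)
qed

lemma card_le_1_unique: "finite A \<Longrightarrow> card A \<le> 1 \<Longrightarrow> x \<in> A \<Longrightarrow> y \<in> A \<Longrightarrow> x = y"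
  using card_le_Suc0_iff_eq[of A] by simp

lemma card_le_1_if_unique: "(\<And>x y. x \<in> A \<Longrightarrow> y \<in> A \<Longrightarrow> x = y) \<Longrightarrow> card A \<le> 1"
  by (metis One_nat_def card.infinite card_le_Suc0_iff_eq zero_le)

lemma path_orientation_iff_orients:
  assumes f: "forest n E" and F: "F \<subseteq> E"
  shows "path_orientation F D \<longleftrightarrow> orients F D"
proof
  have finF: "finite F" using f F forest_finite finite_subset by metis
  have edge: "\<exists>a b. e = {a, b}" if "e \<in> F" for e
    using that F forest_edgeE[OF f, of e] by blast
  {
    assume p: "path_orientation F D"
    then have bij: "bij_betw (\<lambda>(a, b). {a, b}) D F"
      and c: "\<And>v. card {a. (a, v) \<in> D} \<le> 1" "\<And>v. card {b. (v, b) \<in> D} \<le> 1"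
      unfolding path_orientation_def by simp_all
    have finD: "finite D" using bij finF bij_betw_finite by metis
    \<comment> \<open>An infinite set has \<open>card\<close> 0, so the bounds in \<open>c\<close>
      yield uniqueness only together with finiteness.\<close>
    have fin: "finite {a. (a, v) \<in> D}" "finite {b. (v, b) \<in> D}" for v
    proof -
      have "{a. (a, v) \<in> D} \<subseteq> fst ` D" "{b. (v, b) \<in> D} \<subseteq> snd ` D" by force+
      then show "finite {a. (a, v) \<in> D}" "finite {b. (v, b) \<in> D}"
        using finD finite_subset by blast+
    qed
    have inF: "{a, b} \<in> F" if "(a, b) \<in> D" for a b
      using bij_betw_apply[OF bij that] by simp
    show "orients F D"
    proof (rule orientsI)
      fix a b x
      show "{a, b} \<in> F \<longleftrightarrow> (a, b) \<in> D \<or> (b, a) \<in> D"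
      proof
        assume "{a, b} \<in> F"
        then have "{a, b} \<in> (\<lambda>(a, b). {a, b}) ` D" using bij by (simp add: bij_betw_def)
        then obtain c d where "(c, d) \<in> D" "{a, b} = {c, d}" by auto
        then show "(a, b) \<in> D \<or> (b, a) \<in> D" by (auto simp: doubleton_eq_iff)
      next
        assume "(a, b) \<in> D \<or> (b, a) \<in> D"
        then show "{a, b} \<in> F" using inF[of a b] inF[of b a] by (auto simp: insert_commute)
      qed
      show "(b, a) \<notin> D" if "(a, b) \<in> D"
      proof
        assume ba: "(b, a) \<in> D"
        have "(a, b) = (b, a)"
          by (rule inj_onD[OF bij_betw_imp_inj_on[OF bij] _ that ba]) (simp add: insert_commute)
        moreover have "{a, b} \<in> E" using inF[OF that] F by blast
        ultimately show False using forest_edgeD(1)[OF f, of a b] by simp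
      qed
      show "b = x" if "(a, b) \<in> D" "(a, x) \<in> D"
        using card_le_1_unique[OF fin(2) c(2), of b a x] that by simp
      show "b = x" if "(b, a) \<in> D" "(x, a) \<in> D"
        using card_le_1_unique[OF fin(1) c(1), of b a x] that by simp
    qed
  next
    assume o: "orients F D"
    show "path_orientation F D"
      unfolding path_orientation_def
    proof (intro conjI allI)
      show "bij_betw (\<lambda>(a, b). {a, b}) D F" using o edge by (rule orients_bij_betw)
      show "card {a. (a, v) \<in> D} \<le> 1" for v
        by (rule card_le_1_if_unique, rule orientsD(4)[OF o, of _ v]) simp_all
      show "card {b. (v, b) \<in> D} \<le> 1" for v
        by (rule card_le_1_if_unique, rule orientsD(3)[OF o, of v]) simp_all
    qed
  }
qed

section \<open>Minors of the Laplacian\<close>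

text \<open>Reordering rows or columns and normalising the leading coefficient change a minor at
  most by a sign, and ideal membership ignores signs. So they need not be tracked.\<close>

definition eq_up_to_sign :: "'a::ab_group_add \<Rightarrow> 'a \<Rightarrow> bool" where
  "eq_up_to_sign p q \<longleftrightarrow> p = q \<or> p = - q"

lemma eq_up_to_sign_trans: "eq_up_to_sign p q \<Longrightarrow> eq_up_to_sign q r \<Longrightarrow> eq_up_to_sign p r"
  by (auto simp: eq_up_to_sign_def)

lemma eq_up_to_sign_sym: "eq_up_to_sign p q \<Longrightarrow> eq_up_to_sign q p"
  by (auto simp: eq_up_to_sign_def)

lemma eq_up_to_sign_power_neg_1: "eq_up_to_sign ((- 1) ^ k * p) (p :: 'a::comm_ring_1)"
  by (cases "even k") (simp_all add: eq_up_to_sign_def)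

text \<open>Rows and columns in a freely chosen order, so that the head and the tail of an arc can
  be placed at the same position.\<close>

definition list_minor :: "nat set set \<Rightarrow> nat list \<Rightarrow> nat list \<Rightarrow> mpoly" where
  "list_minor E xs ys = det (mat (length xs) (length ys) (\<lambda>(a, b). gen_laplacian E (xs ! a) (ys ! b)))"

lemma gen_laplacian_commute: "gen_laplacian E u v = gen_laplacian E v u"
  by (simp add: gen_laplacian_def insert_commute)

text \<open>Transposition combined with the symmetry of the Laplacian; it lets facts about rows
  serve for columns.\<close>

lemma list_minor_commute:
  assumes "length xs = length ys"
  shows "list_minor E xs ys = list_minor E ys xs"
proof -
  let ?A = "mat (length xs) (length xs) (\<lambda>(a, b). gen_laplacian E (xs ! a) (ys ! b))"
  have "transpose_mat ?A = mat (length xs) (length xs) (\<lambda>(a, b). gen_laplacian E (ys ! a) (xs ! b))"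
    by (rule eq_matI) (auto simp: gen_laplacian_commute)
  moreover have "det (transpose_mat ?A) = det ?A" by (rule det_transpose[of _ "length xs"]) simp
  ultimately show ?thesis using assms by (simp add: list_minor_def)
qed

lemma list_minor_reorder_rows:
  assumes "distinct xs" "distinct xs'" "set xs = set xs'" "length ys = length xs"
  shows "eq_up_to_sign (list_minor E xs ys) (list_minor E xs' ys)"
proof -
  let ?n = "length xs'"
  have len: "length xs = ?n" using assms distinct_card by metis
  have "mset xs = mset xs'" using assms set_eq_iff_mset_eq_distinct by blast
  then obtain p where p: "p permutes {..<?n}" "permute_list p xs' = xs"
    by (rule mset_eq_permutation)
  let ?A = "mat ?n ?n (\<lambda>(a, b). gen_laplacian E (xs' ! a) (ys ! b))"
  have p0: "p permutes {0..<?n}" using p(1) by (simp add: atLeast0LessThan)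
  have "mat ?n ?n (\<lambda>(a, b). gen_laplacian E (xs ! a) (ys ! b)) = mat ?n ?n (\<lambda>(a, b). ?A $$ (p a, b))"
  proof (rule eq_matI)
    fix i j assume "i < dim_row (mat ?n ?n (\<lambda>(a, b). ?A $$ (p a, b)))"
      "j < dim_col (mat ?n ?n (\<lambda>(a, b). ?A $$ (p a, b)))"
    then have ij: "i < ?n" "j < ?n" by simp_all
    then have "p i < ?n" using permutes_in_image[OF p(1), of i] by simp
    then show "mat ?n ?n (\<lambda>(a, b). gen_laplacian E (xs ! a) (ys ! b)) $$ (i, j) =
        mat ?n ?n (\<lambda>(a, b). ?A $$ (p a, b)) $$ (i, j)"
      using ij permute_list_nth[OF p(1) ij(1)] p(2) by simp
  qed simp_all
  moreover have "det (mat ?n ?n (\<lambda>(a, b). ?A $$ (p a, b))) = signof p * det ?A"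
    by (rule det_permute_rows) (simp_all add: p0)
  ultimately have "list_minor E xs ys = signof p * list_minor E xs' ys"
    using assms(4) len by (simp add: list_minor_def)
  then show ?thesis by (cases "evenperm p") (simp_all add: sign_def eq_up_to_sign_def)
qed

lemma list_minor_reorder:
  assumes "distinct xs" "distinct xs'" "set xs = set xs'"
    and "distinct ys" "distinct ys'" "set ys = set ys'" "length ys = length xs"
  shows "eq_up_to_sign (list_minor E xs ys) (list_minor E xs' ys')"
proof -
  have len: "length xs' = length xs" "length ys' = length ys" using assms distinct_card by metis+
  have "eq_up_to_sign (list_minor E xs ys) (list_minor E xs' ys)"
    using list_minor_reorder_rows assms by blast
  moreover have "list_minor E xs' ys = list_minor E ys xs'"
    using list_minor_commute len assms by metis
  moreover have "eq_up_to_sign (list_minor E ys xs') (list_minor E ys' xs')"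
    using list_minor_reorder_rows assms len by metis
  moreover have "list_minor E ys' xs' = list_minor E xs' ys'"
    using list_minor_commute len assms by metis
  ultimately show ?thesis using eq_up_to_sign_trans by metis
qed

lemma minor_eq_list_minor:
  assumes "distinct xs" "distinct ys" "length xs = length ys"
  shows "eq_up_to_sign (minor E (set xs) (set ys)) (list_minor E xs ys)"
proof -
  have "minor E (set xs) (set ys) = list_minor E (sorted_list_of_set (set xs)) (sorted_list_of_set (set ys))"
    by (simp add: minor_def list_minor_def)
  moreover have "eq_up_to_sign \<dots> (list_minor E xs ys)"
    by (rule list_minor_reorder) (use assms in \<open>simp_all add: distinct_card\<close>)
  ultimately show ?thesis by simp
qed

lemma list_minor_laplace:
  assumes "length ys = Suc (length xs)"
  shows "list_minor E (u # xs) ys = (\<Sum>j<length ys. gen_laplacian E u (ys ! j) *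
    ((- 1) ^ j * list_minor E xs (take j ys @ drop (Suc j) ys)))"
proof -
  let ?n = "length ys"
  let ?A = "mat ?n ?n (\<lambda>(a, b). gen_laplacian E ((u # xs) ! a) (ys ! b))"
  have "list_minor E (u # xs) ys = det ?A" using assms by (simp add: list_minor_def)
  also have "\<dots> = (\<Sum>j<?n. ?A $$ (0, j) * cofactor ?A 0 j)"
    by (rule laplace_expansion_row) (use assms in simp_all)
  also have "\<dots> = (\<Sum>j<?n. gen_laplacian E u (ys ! j) *
    ((- 1) ^ j * list_minor E xs (take j ys @ drop (Suc j) ys)))"
  proof (rule sum.cong[OF refl])
    fix j assume "j \<in> {..<?n}"
    then have j: "j < ?n" by simp
    have "mat_delete ?A 0 j = mat (length xs) (length xs)
      (\<lambda>(a, b). gen_laplacian E (xs ! a) ((take j ys @ drop (Suc j) ys) ! b))"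
      by (rule eq_matI) (use j assms in \<open>auto simp: mat_delete_def nth_append\<close>)
    then have "cofactor ?A 0 j = (- 1) ^ j * list_minor E xs (take j ys @ drop (Suc j) ys)"
      using j assms by (simp add: cofactor_def list_minor_def)
    then show "?A $$ (0, j) * cofactor ?A 0 j = gen_laplacian E u (ys ! j) *
      ((- 1) ^ j * list_minor E xs (take j ys @ drop (Suc j) ys))"
      using j assms by simp
  qed
  finally show ?thesis .
qed

section \<open>Minors attached to oriented 2-matchings\<close>

text \<open>Fix an arc from \<open>ys ! i\<close> to \<open>xs ! i\<close> and the cut given by its edge. Going from columns
  to rows, the identity pairing gains one vertex on the side of \<open>xs ! i\<close>; every other pairing along
  edges and loops has the same gain, hence must use the arc as well.\<close>

lemma arc_pairing_unique:
  assumes f: "forest n E" and dist: "distinct xs" "distinct ys" and len: "length xs = N" "length ys = N"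
    and k: "k \<le> N" and arcs: "\<And>i. i < k \<Longrightarrow> {xs ! i, ys ! i} \<in> E"
    and loops: "\<And>i. k \<le> i \<Longrightarrow> i < N \<Longrightarrow> xs ! i = ys ! i"
    and asym: "\<And>i l. i < k \<Longrightarrow> l < k \<Longrightarrow> xs ! i = ys ! l \<Longrightarrow> ys ! i \<noteq> xs ! l"
    and p: "p permutes {0..<N}"
    and pe: "\<And>i. i < N \<Longrightarrow> xs ! i = ys ! p i \<or> {xs ! i, ys ! p i} \<in> E"
    and i: "i < k"
  shows "p i = i"
proof (rule ccontr)
  assume np: "p i \<noteq> i"
  have iN: "i < N" using i k by simp
  have pN: "p l < N" if "l < N" for l using permutes_in_image[OF p, of l] that by simp
  obtain U where U: "xs ! i \<in> U" "ys ! i \<notin> U"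
    "\<And>a b. {a, b} \<in> E \<Longrightarrow> a \<in> U \<Longrightarrow> b \<notin> U \<Longrightarrow> a = xs ! i \<and> b = ys ! i"
    using forest_cutE[OF f arcs[OF i]] by metis
  let ?X = "{l. l < N \<and> xs ! l \<in> U}" and ?Y = "{l. l < N \<and> ys ! l \<in> U}"
    and ?Z = "{l. l < N \<and> ys ! p l \<in> U}"
  \<comment> \<open>A row inside \<open>U\<close> paired with a column outside would use the unique
    crossing edge; then the row index is \<open>i\<close> and \<open>p i = i\<close>, against the
    assumption.\<close>
  have sub1: "?X \<subseteq> ?Z"
  proof
    fix l assume "l \<in> ?X"
    then have l: "l < N" "xs ! l \<in> U" by simp_all
    have "ys ! p l \<in> U"
    proof (rule ccontr)
      assume n: "ys ! p l \<notin> U"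
      then have "xs ! l \<noteq> ys ! p l" using l(2) by metis
      then have "{xs ! l, ys ! p l} \<in> E" using pe[OF l(1)] by simp
      from U(3)[OF this l(2) n] have e: "xs ! l = xs ! i" "ys ! p l = ys ! i" by simp_all
      have "l = i" using nth_eq_iff_index_eq[OF dist(1), of l i] e(1) l(1) iN len by simp
      moreover have "p l = i" using nth_eq_iff_index_eq[OF dist(2), of "p l" i] e(2) pN[OF l(1)] iN len by simp
      ultimately show False using np by simp
    qed
    then show "l \<in> ?Z" using l by simp
  qed
  \<comment> \<open>A column inside \<open>U\<close> with its row outside would be the arc opposite
    to arc \<open>i\<close>, which \<open>asym\<close> excludes. The inclusion is strict because of
    \<open>i\<close>. As \<open>?Z\<close> is \<open>?Y\<close> reindexed by \<open>p\<close>, the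
    sizes contradict \<open>sub1\<close>.\<close>
  have sub2: "?Y \<subset> ?X"
  proof (rule psubsetI)
    show "?Y \<subseteq> ?X"
    proof
      fix l assume "l \<in> ?Y"
      then have l: "l < N" "ys ! l \<in> U" by simp_all
      have "xs ! l \<in> U"
      proof (rule ccontr)
        assume n: "xs ! l \<notin> U"
        then have "xs ! l \<noteq> ys ! l" using l(2) by metis
        then have lk: "l < k" using loops[of l] l(1) by (meson not_le)
        then have "{ys ! l, xs ! l} \<in> E" using arcs[of l] by (simp add: insert_commute)
        from U(3)[OF this l(2) n] show False using asym[OF lk i] by simp
      qed
      then show "l \<in> ?X" using l by simp
    qed
    show "?Y \<noteq> ?X" using U(1,2) iN by auto
  qed
  have "card ?Z = card ?Y"
  proof (rule bij_betw_same_card[of p])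
    show "bij_betw p ?Z ?Y"
      unfolding bij_betw_def
    proof
      show "inj_on p ?Z" by (rule inj_on_subset[OF permutes_inj[OF p] subset_UNIV])
      show "p ` ?Z = ?Y"
      proof (intro equalityI subsetI)
        fix y assume "y \<in> ?Y"
        moreover from this have "y \<in> p ` {0..<N}" using permutes_image[OF p] by simp
        ultimately show "y \<in> p ` ?Z" by auto
      qed (use pN in auto)
    qed
  qed
  moreover have "card ?X \<le> card ?Z" by (rule card_mono[OF _ sub1]) simp
  moreover have "card ?Y < card ?X" by (rule psubset_card_mono[OF _ sub2]) simp
  ultimately show False by simp
qed

lemma gen_laplacian_nonzero: "gen_laplacian E u v \<noteq> 0 \<Longrightarrow> u = v \<or> {u, v} \<in> E"
  by (simp add: gen_laplacian_def split: if_splits)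

text \<open>Compared term by term in the Leibniz formula with the block diagonal matrix formed by
  minus the identity of size \<open>k\<close> and the principal block on \<open>ss\<close>. A
  nonzero term fixes every arc position, and there both matrices have the same entries.\<close>

lemma list_minor_append:
  assumes f: "forest n E" and dist: "distinct (hs @ ss)" "distinct (ts @ ss)"
    and len: "length hs = k" "length ts = k" and arcs: "\<And>i. i < k \<Longrightarrow> {hs ! i, ts ! i} \<in> E"
    and asym: "\<And>i l. i < k \<Longrightarrow> l < k \<Longrightarrow> hs ! i = ts ! l \<Longrightarrow> ts ! i \<noteq> hs ! l"
  shows "list_minor E (hs @ ss) (ts @ ss) = (- 1) ^ k * list_minor E ss ss"
proof -
  let ?m = "length ss"
  let ?N = "k + ?m"
  let ?A = "mat ?N ?N (\<lambda>(a, b). gen_laplacian E ((hs @ ss) ! a) ((ts @ ss) ! b))"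
  let ?P = "mat ?m ?m (\<lambda>(a, b). gen_laplacian E (ss ! a) (ss ! b))"
  let ?B = "four_block_mat ((- 1) \<cdot>\<^sub>m 1\<^sub>m k) (0\<^sub>m k ?m) (0\<^sub>m ?m k) ?P"
  have B: "?B $$ (i, j) = (if i < k then (if i = j then - 1 else 0) else if j < k then 0
      else gen_laplacian E (ss ! (i - k)) (ss ! (j - k)))" if "i < ?N" "j < ?N" for i j
    using that by auto
  have A: "?A $$ (i, j) = gen_laplacian E ((hs @ ss) ! i) ((ts @ ss) ! j)" if "i < ?N" "j < ?N" for i j
    using that by simp
  have diag: "?A $$ (i, i) = - 1" if "i < k" for i
    using A[of i i] that arcs[OF that] forest_edgeD(1)[OF f arcs[OF that]] len
    by (simp add: nth_append gen_laplacian_def)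
  \<comment> \<open>Because of this, a factor vanishing in \<open>?A\<close> vanishes in
    \<open>?B\<close> too, so only permutations with nonzero product need an argument.\<close>
  have BA: "?B $$ (i, j) = 0 \<or> ?B $$ (i, j) = ?A $$ (i, j)" if "i < ?N" "j < ?N" for i j
    using B[OF that] A[OF that] diag[of i] len by (auto simp: nth_append)
  have prods: "(\<Prod>i = 0..<?N. ?A $$ (i, p i)) = (\<Prod>i = 0..<?N. ?B $$ (i, p i))"
    if p: "p permutes {0..<?N}" for p
  proof -
    have pN: "p i < ?N" if "i < ?N" for i using permutes_in_image[OF p, of i] that by simp
    show ?thesis
    proof (cases "\<exists>i<?N. ?A $$ (i, p i) = 0")
      case True
      then obtain i where i: "i < ?N" "?A $$ (i, p i) = 0" by metis
      then have "?B $$ (i, p i) = 0" using BA[OF i(1) pN[OF i(1)]] by metis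
      then show ?thesis using i prod_zero[of "{0..<?N}"]
        by (metis (no_types, lifting) atLeastLessThan_iff finite_atLeastLessThan zero_le)
    next
      case False
      have fix_p: "p i = i" if "i < k" for i
      proof (rule arc_pairing_unique[OF f dist, of ?N k])
        show "length (hs @ ss) = ?N" "length (ts @ ss) = ?N" using len by simp_all
        show "{(hs @ ss) ! i, (ts @ ss) ! i} \<in> E" if "i < k" for i
          using arcs[OF that] that len by (simp add: nth_append)
        show "(hs @ ss) ! i = (ts @ ss) ! i" if "k \<le> i" for i
          using that len by (simp add: nth_append)
        show "(ts @ ss) ! i \<noteq> (hs @ ss) ! l" if "i < k" "l < k" "(hs @ ss) ! i = (ts @ ss) ! l" for i l
          using asym[of i l] that len by (simp add: nth_append)
        show "(hs @ ss) ! i = (ts @ ss) ! p i \<or> {(hs @ ss) ! i, (ts @ ss) ! p i} \<in> E" if "i < ?N" for i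
          using False that A[OF that pN[OF that]] gen_laplacian_nonzero by metis
      qed (use p that in simp_all)
      have ge: "p i \<ge> k" if "i \<ge> k" for i
      proof (rule ccontr)
        assume "\<not> p i \<ge> k"
        then have "p (p i) = p i" "p i < k" using fix_p by simp_all
        then have "p i = i" using permutes_inj[OF p] by (metis injD)
        then show False using \<open>p i < k\<close> that by simp
      qed
      have "?A $$ (i, p i) = ?B $$ (i, p i)" if "i < ?N" for i
      proof (cases "i < k")
        case True
        then show ?thesis using B[OF that pN[OF that]] diag[of i] fix_p[of i] by simp
      next
        case False
        then show ?thesis using B[OF that pN[OF that]] A[OF that pN[OF that]] ge[of i] len
          by (simp add: nth_append)
      qed
      then show ?thesis by (intro prod.cong) simp_all
    qed
  qed
  have "list_minor E (hs @ ss) (ts @ ss) = det ?A" using len by (simp add: list_minor_def)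
  also have "\<dots> = (\<Sum>p\<in>{p. p permutes {0..<?N}}. signof p * (\<Prod>i = 0..<?N. ?A $$ (i, p i)))"
    by (rule det_def'[of _ ?N]) simp
  also have "\<dots> = (\<Sum>p\<in>{p. p permutes {0..<?N}}. signof p * (\<Prod>i = 0..<?N. ?B $$ (i, p i)))"
    using prods by (intro sum.cong) simp_all
  also have "\<dots> = det ?B" by (rule det_def'[of _ ?N, symmetric]) (rule four_block_carrier_mat; simp)
  also have "\<dots> = det ((- 1) \<cdot>\<^sub>m 1\<^sub>m k :: mpoly mat) * det ?P"
    by (rule det_four_block_mat_lower_left_zero[of _ k _ ?m]) simp_all
  also have "\<dots> = (- 1) ^ k * list_minor E ss ss" by (simp add: list_minor_def)
  finally show ?thesis .
qed

lemma orients_subset: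
  assumes "forest n E" "F \<subseteq> E" "orients F D"
  shows "D \<subseteq> {0..<n} \<times> {0..<n}" "finite D"
proof -
  show sub: "D \<subseteq> {0..<n} \<times> {0..<n}"
  proof
    fix x assume "x \<in> D"
    moreover obtain a b where "x = (a, b)" by (metis prod.exhaust)
    ultimately have "{a, b} \<in> E" "x = (a, b)" using orientsD(1)[OF assms(3), of a b] assms(2) by auto
    then show "x \<in> {0..<n} \<times> {0..<n}" using forest_edgeD(2,3)[OF assms(1), of a b] by simp
  qed
  then show "finite D" by (rule finite_subset) simp
qed

text \<open>In a forest the disjoint paths linking the tails to the heads are forced, so that only
  the principal minor on the loops survives in the expansion.\<close>

lemma minor_heads_tails:
  assumes f: "forest n E" and F: "F \<subseteq> E" and o: "orients F D" and S: "finite S"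
    and disj: "\<And>a b. (a, b) \<in> D \<Longrightarrow> a \<notin> S \<and> b \<notin> S"
  shows "eq_up_to_sign (minor E (heads S D) (tails S D)) (minor E S S)"
    and "card (heads S D) = card F + card S" "card (tails S D) = card F + card S"
proof -
  have finD: "finite D" by (rule orients_subset(2)[OF f F o])
  obtain ds where ds: "set ds = D" "distinct ds" using finite_distinct_list[OF finD] by metis
  obtain ss where ss: "set ss = S" "distinct ss" using finite_distinct_list[OF S] by metis
  \<comment> \<open>Both lists follow the same enumeration of the arcs, which puts each arc on the
    diagonal; the loops come after.\<close>
  define hs ts where "hs = map snd ds" and "ts = map fst ds"
  have inj: "inj_on snd D" "inj_on fst D"
  proof -
    show "inj_on snd D" by (rule inj_onI) (metis orientsD(4)[OF o] prod.collapse)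
    show "inj_on fst D" by (rule inj_onI) (metis orientsD(3)[OF o] prod.collapse)
  qed
  have nth: "(ts ! i, hs ! i) \<in> D" if "i < length ds" for i
    using that ds(1) by (auto simp: hs_def ts_def)
  have dist: "distinct (hs @ ss)" "distinct (ts @ ss)"
    using ds ss inj disj by (auto simp: hs_def ts_def distinct_map)
  have sets: "set (hs @ ss) = heads S D" "set (ts @ ss) = tails S D"
    using ds ss by (force simp: hs_def ts_def heads_def tails_def)+
  have "card F = card D"
    using orients_bij_betw[OF o] forest_edgeE[OF f] F bij_betw_same_card by (metis subsetD)
  then have cF: "card F = length ds" using ds distinct_card by metis
  have cS: "card S = length ss" using ss distinct_card by metis
  show "card (heads S D) = card F + card S" "card (tails S D) = card F + card S"
    using distinct_card[OF dist(1)] distinct_card[OF dist(2)] unfolding sets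
    by (simp_all add: cF cS hs_def ts_def)
  have "list_minor E (hs @ ss) (ts @ ss) = (- 1) ^ length ds * list_minor E ss ss"
  proof (rule list_minor_append[OF f dist])
    show "{hs ! i, ts ! i} \<in> E" if "i < length ds" for i
      using orientsD(1)[OF o, of "hs ! i" "ts ! i"] nth[OF that] F by auto
    show "ts ! i \<noteq> hs ! l" if "i < length ds" "l < length ds" "hs ! i = ts ! l" for i l
      using orientsD(2)[OF o nth[OF that(1)]] nth[OF that(2)] that(3) by auto
  qed (simp_all add: hs_def ts_def)
  then have "eq_up_to_sign (list_minor E (hs @ ss) (ts @ ss)) (list_minor E ss ss)"
    using eq_up_to_sign_power_neg_1 by metis
  moreover have "eq_up_to_sign (minor E (heads S D) (tails S D)) (list_minor E (hs @ ss) (ts @ ss))"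
    using minor_eq_list_minor[OF dist] sets by (simp add: hs_def ts_def)
  moreover have "eq_up_to_sign (list_minor E ss ss) (minor E S S)"
    using eq_up_to_sign_sym[OF minor_eq_list_minor[OF ss(2) ss(2) refl]] ss(1) by simp
  ultimately show "eq_up_to_sign (minor E (heads S D) (tails S D)) (minor E S S)"
    using eq_up_to_sign_trans by metis
qed

text \<open>A nonzero determinant has a nonzero Leibniz term; its permutation is carried over from
  indices to vertices.\<close>

lemma minor_nonzero_pairing:
  assumes RC: "finite R" "finite C" "card R = card C" and nz: "minor E R C \<noteq> 0"
  shows "\<exists>\<sigma>. bij_betw \<sigma> R C \<and> (\<forall>r\<in>R. gen_laplacian E r (\<sigma> r) \<noteq> 0)"
proof -
  let ?n = "card C"
  define xs ys where "xs = sorted_list_of_set R" and "ys = sorted_list_of_set C"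
  have xs: "distinct xs" "set xs = R" "length xs = ?n" and ys: "distinct ys" "set ys = C" "length ys = ?n"
    using RC by (simp_all add: xs_def ys_def)
  let ?A = "mat ?n ?n (\<lambda>(a, b). gen_laplacian E (xs ! a) (ys ! b))"
  have "det ?A \<noteq> 0" using nz RC(3) by (simp add: minor_def xs_def ys_def)
  moreover have "det ?A = (\<Sum>p\<in>{p. p permutes {0..<?n}}. signof p * (\<Prod>i = 0..<?n. ?A $$ (i, p i)))"
    by (rule det_def'[of _ ?n]) simp
  ultimately obtain p where p: "p permutes {0..<?n}" "signof p * (\<Prod>i = 0..<?n. ?A $$ (i, p i)) \<noteq> 0"
    by (metis (mono_tags, lifting) mem_Collect_eq sum.not_neutral_contains_not_neutral)
  have pn: "p i < ?n" if "i < ?n" for i using permutes_in_image[OF p(1), of i] that by simp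
  have nz': "gen_laplacian E (xs ! i) (ys ! p i) \<noteq> 0" if "i < ?n" for i
  proof
    assume "gen_laplacian E (xs ! i) (ys ! p i) = 0"
    then have "?A $$ (i, p i) = 0" using that pn[OF that] by simp
    then have "(\<Prod>i = 0..<?n. ?A $$ (i, p i)) = 0" using that by (intro prod_zero) auto
    then show False using p(2) by simp
  qed
  have b1: "bij_betw ((!) xs) {0..<?n} R" by (rule bij_betw_nth) (simp_all add: xs atLeast0LessThan)
  have b2: "bij_betw ((!) ys) {0..<?n} C" by (rule bij_betw_nth) (simp_all add: ys atLeast0LessThan)
  have b3: "bij_betw p {0..<?n} {0..<?n}" by (rule permutes_imp_bij[OF p(1)])
  define g where "g = inv_into {0..<?n} ((!) xs)"
  have b4: "bij_betw g R {0..<?n}" unfolding g_def by (rule bij_betw_inv_into[OF b1])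
  have "bij_betw ((!) ys \<circ> (p \<circ> g)) R C"
    by (rule bij_betw_trans[OF bij_betw_trans[OF b4 b3] b2])
  moreover have "gen_laplacian E r (((!) ys \<circ> (p \<circ> g)) r) \<noteq> 0" if "r \<in> R" for r
  proof -
    have "g r < ?n" using bij_betwE[OF b4] that by auto
    moreover have "xs ! g r = r" unfolding g_def by (rule bij_betw_inv_into_right[OF b1 that])
    ultimately show ?thesis using nz'[of "g r"] by simp
  qed
  ultimately show ?thesis by (intro exI[of _ "(!) ys \<circ> (p \<circ> g)"]) simp
qed

text \<open>A nonzero term of the expansion pairs rows with columns along edges and loops; a pair of
  opposite arcs is replaced by two loops.\<close>

lemma minor_nonzero_heads_tails:
  assumes RC: "finite R" "finite C" "card R = card C" and nz: "minor E R C \<noteq> 0"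
  shows "\<exists>F D S. F \<subseteq> E \<and> orients F D \<and> S \<subseteq> R \<and> heads S D = R \<and> tails S D = C \<and>
    (\<forall>a b. (a, b) \<in> D \<longrightarrow> a \<notin> S \<and> b \<notin> S)"
proof -
  obtain \<sigma> where bij: "bij_betw \<sigma> R C" and lap: "\<And>r. r \<in> R \<Longrightarrow> gen_laplacian E r (\<sigma> r) \<noteq> 0"
    using minor_nonzero_pairing[OF assms] by metis
  have inj: "r = s" if "r \<in> R" "s \<in> R" "\<sigma> r = \<sigma> s" for r s
    using inj_onD[OF bij_betw_imp_inj_on[OF bij]] that by metis
  have mem: "\<sigma> r \<in> C" if "r \<in> R" for r using bij_betwE[OF bij] that by metis
  have surj: "\<exists>r\<in>R. c = \<sigma> r" if "c \<in> C" for c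
    using bij_betw_imp_surj_on[OF bij] that by (metis imageE)
  \<comment> \<open>\<open>sy\<close> marks the fixed points and the 2-cycles of
    \<open>\<sigma>\<close>. Both vertices of a 2-cycle are rows as well as columns, so turning them
    into loops preserves the sets of heads and tails.\<close>
  define sy where "sy r \<longleftrightarrow> \<sigma> r = r \<or> (\<sigma> r \<in> R \<and> \<sigma> (\<sigma> r) = r)" for r
  define S where "S = {r \<in> R. sy r}"
  define D where "D = {(a, b). b \<in> R \<and> a = \<sigma> b \<and> \<not> sy b}"
  define F where "F = {e. \<exists>a b. e = {a, b} \<and> (a, b) \<in> D}"
  have Diff: "(a, b) \<in> D \<longleftrightarrow> b \<in> R \<and> a = \<sigma> b \<and> \<not> sy b" for a b
    by (simp add: D_def)
  have "{a, b} \<in> F \<longleftrightarrow> (a, b) \<in> D \<or> (b, a) \<in> D" for a b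
    unfolding F_def mem_Collect_eq by (metis doubleton_eq_iff)
  then have "orients F D"
  proof (rule orientsI)
    show "(b, a) \<notin> D" if "(a, b) \<in> D" for a b
      using that unfolding Diff sy_def by metis
    show "b = c" if "(a, b) \<in> D" "(a, c) \<in> D" for a b c
      using that inj unfolding Diff by metis
    show "b = c" if "(b, a) \<in> D" "(c, a) \<in> D" for a b c
      using that unfolding Diff by metis
  qed
  moreover have "F \<subseteq> E"
  proof
    fix e assume "e \<in> F"
    then obtain b where b: "e = {\<sigma> b, b}" "b \<in> R" "\<not> sy b" unfolding F_def mem_Collect_eq Diff by metis
    then have "\<sigma> b \<noteq> b" by (simp add: sy_def)
    then show "e \<in> E" using gen_laplacian_nonzero[OF lap[OF b(2)]] b(1) by (auto simp: insert_commute)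
  qed
  moreover have "S \<subseteq> R" by (auto simp: S_def)
  moreover have "heads S D = R" by (auto simp: heads_def S_def Diff)
  moreover have "tails S D = C"
  proof (intro equalityI subsetI)
    fix c assume "c \<in> tails S D"
    then consider b where "b \<in> R" "c = \<sigma> b" | "c \<in> R" "sy c"
      unfolding tails_def S_def Un_iff mem_Collect_eq Diff by metis
    then show "c \<in> C"
    proof cases
      case 1
      then show ?thesis using mem by simp
    next
      case 2
      then show ?thesis using mem unfolding sy_def by metis
    qed
  next
    fix c assume "c \<in> C"
    then obtain r where r: "r \<in> R" "c = \<sigma> r" using surj by metis
    show "c \<in> tails S D"
    proof (cases "sy r")
      case True
      then have "c \<in> R \<and> sy c" using r unfolding sy_def by metis
      then show ?thesis by (simp add: tails_def S_def)
    next
      case False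
      then have "(c, r) \<in> D" using r Diff by simp
      then show ?thesis unfolding tails_def by blast
    qed
  qed
  moreover have "a \<notin> S \<and> b \<notin> S" if "(a, b) \<in> D" for a b
  proof
    \<comment> \<open>If \<open>a = \<sigma> b\<close> were in \<open>S\<close>, injectivity would
      put \<open>b\<close> on the same fixed point or 2-cycle, contradicting
      \<open>\<not> sy b\<close>.\<close>
    show "a \<notin> S" using that inj unfolding S_def mem_Collect_eq Diff sy_def by metis
    show "b \<notin> S" using that unfolding S_def mem_Collect_eq Diff by metis
  qed
  ultimately show ?thesis by metis
qed

section \<open>Generated ideals and expansion of principal minors\<close>

lemma ideal_gen_base: "p \<in> G \<Longrightarrow> p \<in> ideal_gen G"
  unfolding ideal_gen_def mem_Collect_eq by (intro exI[of _ "{p}"] exI[of _ "\<lambda>_. 1"]) simp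

lemma ideal_gen_0: "0 \<in> ideal_gen G"
  unfolding ideal_gen_def mem_Collect_eq by (intro exI[of _ "{}"]) simp

lemma ideal_gen_add:
  assumes "p \<in> ideal_gen G" "q \<in> ideal_gen G"
  shows "p + q \<in> ideal_gen G"
proof -
  obtain A c where A: "finite A" "A \<subseteq> G" "p = (\<Sum>f\<in>A. c f * f)"
    using assms(1) unfolding ideal_gen_def mem_Collect_eq by metis
  obtain B d where B: "finite B" "B \<subseteq> G" "q = (\<Sum>f\<in>B. d f * f)"
    using assms(2) unfolding ideal_gen_def mem_Collect_eq by metis
  \<comment> \<open>Coefficients are extended by 0 to the union of the two supports, where they can
    be added.\<close>
  have "p = (\<Sum>f\<in>A \<union> B. (if f \<in> A then c f else 0) * f)"
    unfolding A(3) by (rule sum.mono_neutral_cong_left) (use A B in auto)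
  moreover have "q = (\<Sum>f\<in>A \<union> B. (if f \<in> B then d f else 0) * f)"
    unfolding B(3) by (rule sum.mono_neutral_cong_left) (use A B in auto)
  ultimately have "p + q = (\<Sum>f\<in>A \<union> B. ((if f \<in> A then c f else 0) + (if f \<in> B then d f else 0)) * f)"
    by (simp add: sum.distrib distrib_right)
  then show ?thesis unfolding ideal_gen_def mem_Collect_eq
    by (rule_tac exI[of _ "A \<union> B"], rule_tac exI) (use A B in auto)
qed

lemma ideal_gen_mult:
  assumes "p \<in> ideal_gen G"
  shows "r * p \<in> ideal_gen G"
proof -
  obtain A c where A: "finite A" "A \<subseteq> G" "p = (\<Sum>f\<in>A. c f * f)"
    using assms unfolding ideal_gen_def mem_Collect_eq by metis
  then have "r * p = (\<Sum>f\<in>A. (r * c f) * f)" by (simp add: sum_distrib_left mult.assoc)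
  then show ?thesis unfolding ideal_gen_def mem_Collect_eq using A by metis
qed

lemma ideal_gen_sum: "(\<And>i. i \<in> I \<Longrightarrow> f i \<in> ideal_gen G) \<Longrightarrow> sum f I \<in> ideal_gen G"
  by (induction I rule: infinite_finite_induct) (auto intro: ideal_gen_0 ideal_gen_add)

lemma ideal_gen_subset:
  assumes "G \<subseteq> ideal_gen H"
  shows "ideal_gen G \<subseteq> ideal_gen H"
proof
  fix p assume "p \<in> ideal_gen G"
  then obtain A c where A: "finite A" "A \<subseteq> G" "p = (\<Sum>f\<in>A. c f * f)"
    unfolding ideal_gen_def mem_Collect_eq by metis
  show "p \<in> ideal_gen H"
    unfolding A(3) by (rule ideal_gen_sum, rule ideal_gen_mult) (use A(2) assms in blast)
qed

lemma ideal_gen_eq_up_to_sign: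
  assumes "eq_up_to_sign p q" "p \<in> ideal_gen G"
  shows "q \<in> ideal_gen G"
proof -
  have "q = 1 * p \<or> q = (- 1) * p" using assms(1) by (auto simp: eq_up_to_sign_def)
  then show ?thesis using ideal_gen_mult[OF assms(2)] by metis
qed

lemma sign_normalize_eq_up_to_sign: "eq_up_to_sign p (sign_normalize p)"
  by (simp add: sign_normalize_def eq_up_to_sign_def)

text \<open>In the row of \<open>u\<close> only \<open>u\<close> and its neighbours in
  \<open>S\<close> have nonzero entries. The cofactor of a neighbour \<open>w\<close> has rows
  \<open>S - {u}\<close> and columns \<open>S - {w}\<close>: these are the heads and tails of the
  single arc \<open>(u, w)\<close> with loops \<open>S - {u, w}\<close>, so it is a principal minor
  up to sign.\<close>

lemma minor_laplace_in_ideal: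
  assumes f: "forest n E" and S: "S \<subseteq> {0..<n}" and u: "u \<in> S"
    and 1: "minor E (S - {u}) (S - {u}) \<in> ideal_gen G"
    and 2: "\<And>w. w \<in> S \<Longrightarrow> {u, w} \<in> E \<Longrightarrow> minor E (S - {u, w}) (S - {u, w}) \<in> ideal_gen G"
  shows "minor E S S \<in> ideal_gen G"
proof -
  have finS: "finite S" using S by (rule finite_subset) simp
  obtain xs where xs: "set xs = S - {u}" "distinct xs" using finite_distinct_list[of "S - {u}"] finS by auto
  let ?ys = "u # xs"
  have ys: "set ?ys = S" "distinct ?ys" using xs u by auto
  have off: "minor E (S - {u}) (S - {w}) \<in> ideal_gen G" if w: "w \<in> S" "{u, w} \<in> E" for w
  proof -
    have uw: "u \<noteq> w" using forest_edgeD(1)[OF f w(2)] .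
    have o: "orients {{u, w}} {(u, w)}"
      by (rule orientsI) (use uw in \<open>auto simp: doubleton_eq_iff\<close>)
    have "eq_up_to_sign (minor E (heads (S - {u, w}) {(u, w)}) (tails (S - {u, w}) {(u, w)}))
        (minor E (S - {u, w}) (S - {u, w}))"
      by (rule minor_heads_tails(1)[OF f _ o]) (use w finS in auto)
    moreover have "heads (S - {u, w}) {(u, w)} = S - {u}" "tails (S - {u, w}) {(u, w)} = S - {w}"
      using w u uw by (auto simp: heads_def tails_def)
    ultimately show ?thesis
      using ideal_gen_eq_up_to_sign[OF eq_up_to_sign_sym 2[OF w]] by simp
  qed
  have "list_minor E ?ys ?ys \<in> ideal_gen G"
    unfolding list_minor_laplace[of ?ys xs E u, OF length_Cons]
  proof (rule ideal_gen_sum)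
    fix j assume "j \<in> {..<length ?ys}"
    then have j: "j < length ?ys" by simp
    let ?zs = "take j ?ys @ drop (Suc j) ?ys"
    let ?w = "?ys ! j"
    have w: "?w \<in> S" using ys(1) j nth_mem by blast
    have split: "?ys = take j ?ys @ ?w # drop (Suc j) ?ys" by (rule id_take_nth_drop[OF j])
    then have "distinct (take j ?ys @ ?w # drop (Suc j) ?ys)" "set (take j ?ys @ ?w # drop (Suc j) ?ys) = S"
      using ys by metis+
    then have zs: "distinct ?zs" "set ?zs = S - {?w}" by auto
    have len: "length xs = length ?zs" using j by simp
    show "gen_laplacian E u ?w * ((- 1) ^ j * list_minor E xs ?zs) \<in> ideal_gen G"
    proof (cases "gen_laplacian E u ?w = 0")
      case True
      then show ?thesis using ideal_gen_0 by simp
    next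
      case False
      then have "u = ?w \<or> {u, ?w} \<in> E" by (rule gen_laplacian_nonzero)
      then have "minor E (S - {u}) (S - {?w}) \<in> ideal_gen G" using 1 off[OF w] by metis
      moreover have "eq_up_to_sign (minor E (S - {u}) (S - {?w})) (list_minor E xs ?zs)"
        using minor_eq_list_minor[OF xs(2) zs(1) len, of E] unfolding xs(1) zs(2) .
      ultimately show ?thesis by (intro ideal_gen_mult) (rule ideal_gen_eq_up_to_sign)
    qed
  qed
  then show ?thesis
    using ideal_gen_eq_up_to_sign[OF eq_up_to_sign_sym[OF minor_eq_list_minor[OF ys(2) ys(2) refl, of E]]]
    unfolding ys(1) by metis
qed

section \<open>Generation by minimal 2-matchings\<close>

lemma edge_degree_eq_0I:
  assumes "\<And>e. e \<in> F \<Longrightarrow> v \<notin> e"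
  shows "edge_degree F v = 0"
proof -
  have "{e \<in> F. v \<in> e} = {}" using assms by blast
  then show ?thesis unfolding edge_degree_def by (simp only: card.empty)
qed

lemma edge_degree_outside:
  assumes "forest n E" "F \<subseteq> E" "n \<le> v"
  shows "edge_degree F v = 0"
proof -
  have "v \<notin> e" if "e \<in> F" for e
  proof -
    have "e \<in> E" using that assms(2) by blast
    then obtain x y where "x < n" "y < n" "e = {x, y}" using forest_edgeE[OF assms(1)] by metis
    then show ?thesis using assms(3) by auto
  qed
  then show ?thesis by (rule edge_degree_eq_0I)
qed

text \<open>Beyond \<open>n\<close> there are neither edges nor loops, so the degree bound can be
  used at every \<open>v\<close>.\<close>

lemma two_matchings_iff:
  assumes "forest n E"
  shows "(F, S) \<in> two_matchings n E j \<longleftrightarrow> F \<subseteq> E \<and> S \<subseteq> {0..<n} \<and>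
    (\<forall>v. edge_degree F v + (if v \<in> S then 2 else 0) \<le> 2) \<and> card F + card S = j"
proof -
  have "(\<forall>v<n. edge_degree F v + (if v \<in> S then 2 else 0) \<le> 2) \<longleftrightarrow>
      (\<forall>v. edge_degree F v + (if v \<in> S then 2 else 0) \<le> 2)" if "F \<subseteq> E" "S \<subseteq> {0..<n}"
  proof (intro iffI allI)
    fix v assume *: "\<forall>v<n. edge_degree F v + (if v \<in> S then 2 else 0) \<le> 2"
    show "edge_degree F v + (if v \<in> S then 2 else 0) \<le> 2"
    proof (cases "v < n")
      case False
      then have "v \<notin> S" using that(2) by auto
      then show ?thesis using edge_degree_outside[OF assms that(1)] False by simp
    qed (use * in blast)
  qed blast
  moreover have "(F, S) \<in> two_matchings n E j \<longleftrightarrow> F \<subseteq> E \<and> S \<subseteq> {0..<n} \<and>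
      (\<forall>v<n. edge_degree F v + (if v \<in> S then 2 else 0) \<le> 2) \<and> card F + card S = j"
    by (simp only: two_matchings_def is_two_matching_def edge_degree_def mem_Collect_eq case_prod_conv conj_assoc)
  ultimately show ?thesis by metis
qed

lemma orients_edge_degree_le_2:
  assumes "forest n E" "F \<subseteq> E" "orients F D"
  shows "edge_degree F v \<le> 2"
proof -
  have "{e \<in> F. v \<in> e} \<subseteq> (\<lambda>a. {a, v}) ` {a. (a, v) \<in> D} \<union> (\<lambda>b. {v, b}) ` {b. (v, b) \<in> D}"
  proof
    fix e assume "e \<in> {e \<in> F. v \<in> e}"
    then have e: "e \<in> F" "v \<in> e" by simp_all
    then obtain x y where "e = {x, y}" using forest_edgeE[OF assms(1) subsetD[OF assms(2) e(1)]] by metis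
    then obtain w where w: "e = {v, w}" using e(2) by blast
    then have "(v, w) \<in> D \<or> (w, v) \<in> D" using orientsD(1)[OF assms(3), of v w] e(1) by simp
    then show "e \<in> (\<lambda>a. {a, v}) ` {a. (a, v) \<in> D} \<union> (\<lambda>b. {v, b}) ` {b. (v, b) \<in> D}"
      using w by blast
  qed
  moreover have "card {a. (a, v) \<in> D} \<le> 1" "card {b. (v, b) \<in> D} \<le> 1"
    using iffD2[OF path_orientation_iff_orients[OF assms(1,2)] assms(3)] by (simp_all add: path_orientation_def)
  moreover have fin: "finite {a. (a, v) \<in> D}" "finite {b. (v, b) \<in> D}"
    using orients_subset(1)[OF assms] by (auto intro: finite_subset[of _ "{0..<n}"])
  ultimately have "edge_degree F v \<le> card ((\<lambda>a. {a, v}) ` {a. (a, v) \<in> D} \<union> (\<lambda>b. {v, b}) ` {b. (v, b) \<in> D})"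
    unfolding edge_degree_def by (intro card_mono) simp_all
  also have "\<dots> \<le> card {a. (a, v) \<in> D} + card {b. (v, b) \<in> D}"
    by (rule order_trans[OF card_Un_le add_mono[OF card_image_le[OF fin(1)] card_image_le[OF fin(2)]]])
  finally show ?thesis using \<open>card {a. (a, v) \<in> D} \<le> 1\<close> \<open>card {b. (v, b) \<in> D} \<le> 1\<close> by simp
qed

lemma orients_two_matching:
  assumes f: "forest n E" and F: "F \<subseteq> E" and o: "orients F D" and S: "S \<subseteq> {0..<n}"
    and disj: "\<And>a b. (a, b) \<in> D \<Longrightarrow> a \<notin> S \<and> b \<notin> S"
  shows "(F, S) \<in> two_matchings n E (card F + card S)"
  unfolding two_matchings_iff[OF f]
proof (intro conjI allI)
  fix v
  show "edge_degree F v + (if v \<in> S then 2 else 0) \<le> 2"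
  proof (cases "v \<in> S")
    case True
    have "v \<notin> e" if "e \<in> F" for e
    proof -
      have "e \<in> E" using that F by blast
      then obtain x y where e: "e = {x, y}" using forest_edgeE[OF f] by metis
      then have "(x, y) \<in> D \<or> (y, x) \<in> D" using orientsD(1)[OF o, of x y] that by simp
      then show ?thesis using disj[of x y] disj[of y x] True e by blast
    qed
    then have "edge_degree F v = 0" by (rule edge_degree_eq_0I)
    then show ?thesis by simp
  next
    case False
    then show ?thesis using orients_edge_degree_le_2[OF f F o] by simp
  qed
qed (use F S in simp_all)

lemma two_matching_arcs_avoid_loops:
  assumes f: "forest n E" and m: "(F, S) \<in> two_matchings n E j" and o: "orients F D"
    and ab: "(a, b) \<in> D"
  shows "a \<notin> S \<and> b \<notin> S"
proof -
  have M: "F \<subseteq> E" "\<forall>v. edge_degree F v + (if v \<in> S then 2 else 0) \<le> 2"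
    using m unfolding two_matchings_iff[OF f] by simp_all
  have finF: "finite F" using M(1) forest_finite[OF f] by (rule finite_subset)
  have "{a, b} \<in> F" using orientsD(1)[OF o, of a b] ab by simp
  then have "edge_degree F a \<noteq> 0" "edge_degree F b \<noteq> 0"
    using edge_degree_eq_0_iff[OF finF] by auto
  then show ?thesis using M(2)[rule_format, of a] M(2)[rule_format, of b] by (auto split: if_splits)
qed

text \<open>Induction on the number of loops. The 2-matchings produced by the expansion need not be
  minimal, so the claim has to cover all those of size \<open>j\<close>.\<close>

lemma loops_minor_in_ideal:
  assumes f: "forest n E"
    and base: "\<And>F S. (F, S) \<in> min_two_matchings n E j \<Longrightarrow> minor E S S \<in> ideal_gen G"
  shows "(F, S) \<in> two_matchings n E j \<Longrightarrow> minor E S S \<in> ideal_gen G"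
proof (induction "card S" arbitrary: F S rule: less_induct)
  case less
  have M: "F \<subseteq> E" "S \<subseteq> {0..<n}" "\<And>v. edge_degree F v + (if v \<in> S then 2 else 0) \<le> 2" "card F + card S = j"
    using less.prems unfolding two_matchings_iff[OF f] by simp_all
  have finS: "finite S" using M(2) by (rule finite_subset) simp
  show ?case
  proof (cases "(F, S) \<in> min_two_matchings n E j")
    case True
    then show ?thesis by (rule base)
  next
    case False
    then obtain F' S' where m': "(F', S') \<in> two_matchings n E j" and sub: "S' \<subset> S"
      using less.prems unfolding min_two_matchings_def by blast
    have M': "F' \<subseteq> E" "\<And>v. edge_degree F' v + (if v \<in> S' then 2 else 0) \<le> 2" "card F' + card S' = j"
      using m' unfolding two_matchings_iff[OF f] by simp_all
    have finF: "finite F" "finite F'" using M(1) M'(1) forest_finite[OF f] finite_subset by metis+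
    \<comment> \<open>The two 2-matchings have equal size, so every loop given up by
      \<open>S'\<close> is an additional edge of \<open>F'\<close>: the surplus that
      \<open>augment\<close> requires.\<close>
    define U where "U = S - S'"
    have "card S = card S' + card U"
      unfolding U_def using sub finS card_mono[of S S'] by (subst card_Diff_subset) (auto intro: finite_subset)
    then have cU: "card F' = card F + card U" using M(4) M'(3) by simp
    have "\<exists>u\<in>U. \<exists>K\<subseteq>F \<union> F'. card K = Suc (card F) \<and> (\<forall>v. edge_degree K v \<le> 2) \<and>
        (\<forall>v\<in>U - {u}. edge_degree K v = 0) \<and> edge_degree K u \<le> 1"
    proof (rule augment[OF f M(1) _ M'(1) _ _ _ _ cU])
      show "edge_degree F v \<le> 2" for v using M(3)[of v] by simp
      show "edge_degree F' v \<le> 2" for v using M'(2)[of v] by simp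
      show "U \<subseteq> {..<n}" using M(2) by (auto simp: U_def)
      show "U \<noteq> {}" using sub by (auto simp: U_def)
      show "edge_degree F u = 0" if "u \<in> U" for u
        using M(3)[of u] that by (simp add: U_def)
    qed
    then obtain u K where u: "u \<in> U" and K: "K \<subseteq> F \<union> F'" "card K = Suc (card F)"
      "\<And>v. edge_degree K v \<le> 2" "\<And>v. v \<in> U - {u} \<Longrightarrow> edge_degree K v = 0" "edge_degree K u \<le> 1"
      by metis
    have uS: "u \<in> S" using u by (simp add: U_def)
    have KE: "K \<subseteq> E" using K(1) M(1) M'(1) by blast
    have finK: "finite K" using KE forest_finite[OF f] by (rule finite_subset)
    \<comment> \<open>On \<open>U\<close> this comes from \<open>augment\<close>. The loops of
      \<open>S'\<close> are avoided by both \<open>F\<close> and \<open>F'\<close>, hence by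
      \<open>K\<close>, which is contained in their union.\<close>
    have K0: "edge_degree K v = 0" if "v \<in> S - {u}" for v
    proof (cases "v \<in> S'")
      case True
      have "edge_degree F v = 0" "edge_degree F' v = 0"
        using M(3)[of v] M'(2)[of v] that True by simp_all
      then have "\<forall>e\<in>F \<union> F'. v \<notin> e"
        using edge_degree_eq_0_iff[OF finF(1)] edge_degree_eq_0_iff[OF finF(2)] by blast
      then show ?thesis using edge_degree_eq_0_iff[OF finK] K(1) by blast
    next
      case False
      then show ?thesis using K(4)[of v] that by (simp add: U_def)
    qed
    have cS: "card (S - {u}) = card S - 1" "0 < card S" using uS finS card_gt_0_iff by auto
    show ?thesis
    proof (rule minor_laplace_in_ideal[OF f M(2) uS])
      have "(K, S - {u}) \<in> two_matchings n E j"
        unfolding two_matchings_iff[OF f]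
      proof (intro conjI allI)
        show "edge_degree K v + (if v \<in> S - {u} then 2 else 0) \<le> 2" for v
          using K(3)[of v] K0[of v] by simp
        show "card K + card (S - {u}) = j" using K(2) cS M(4) by simp
      qed (use KE M(2) in auto)
      then show "minor E (S - {u}) (S - {u}) \<in> ideal_gen G"
        using less.hyps cS by simp
    next
      fix w assume w: "w \<in> S" "{u, w} \<in> E"
      have uw: "u \<noteq> w" by (rule forest_edgeD(1)[OF f w(2)])
      have new: "{u, w} \<notin> K" using K0[of w] w uw edge_degree_eq_0_iff[OF finK, of w] by auto
      have deg: "edge_degree (insert {u, w} K) v = edge_degree K v + (if v \<in> {u, w} then 1 else 0)" for v
        by (rule edge_degree_insert[OF finK new])
      have c2: "card (S - {u, w}) = card S - 2" "2 \<le> card S"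
      proof -
        have "{u, w} \<subseteq> S" using uS w by simp
        moreover have "card {u, w} = 2" using uw by simp
        ultimately show "card (S - {u, w}) = card S - 2" "2 \<le> card S"
          using card_Diff_subset[of "{u, w}" S] card_mono[OF finS, of "{u, w}"] by simp_all
      qed
      \<comment> \<open>The new edge raises \<open>u\<close> from at most 1 to at most 2 and
        \<open>w\<close> from 0 to 1; the remaining loops stay free.\<close>
      have "(insert {u, w} K, S - {u, w}) \<in> two_matchings n E j"
        unfolding two_matchings_iff[OF f]
      proof (intro conjI allI)
        show "edge_degree (insert {u, w} K) v + (if v \<in> S - {u, w} then 2 else 0) \<le> 2" for v
          unfolding deg using K(3)[of v] K0[of v] K(5) w uw by (cases "v = u"; cases "v = w") auto
        show "card (insert {u, w} K) + card (S - {u, w}) = j" using K(2) c2 M(4) finK new by simp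
      qed (use KE M(2) w in auto)
      then show "minor E (S - {u, w}) (S - {u, w}) \<in> ideal_gen G"
        using less.hyps c2 by simp
    qed
  qed
qed

theorem theorem3p6:
  fixes n j :: nat and E :: "nat set set"
  assumes "is_tree n E" and "1 \<le> j" and "j \<le> n"
  shows "critical_ideal n E j =
    ideal_gen {d_poly E Lp D | F Lp D. (F, Lp) \<in> min_two_matchings n E j \<and> path_orientation F D}"
    (is "_ = ideal_gen ?G")
proof -
  let ?M = "{minor E R C | R C. R \<subseteq> {0..<n} \<and> C \<subseteq> {0..<n} \<and> card R = j \<and> card C = j}"
  have f: "forest n E" using assms(1) by (rule tree_imp_forest)
  have match: "F \<subseteq> E" "S \<subseteq> {0..<n}" "finite S" "card F + card S = j"
    "\<And>v. edge_degree F v \<le> 2" if "(F, S) \<in> two_matchings n E j" for F S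
  proof -
    show "F \<subseteq> E" "S \<subseteq> {0..<n}" "card F + card S = j"
      using that unfolding two_matchings_iff[OF f] by simp_all
    then show "finite S" using finite_subset[of S "{0..<n}"] by simp
    have "\<forall>v. edge_degree F v + (if v \<in> S then 2 else 0) \<le> 2"
      using that unfolding two_matchings_iff[OF f] by simp
    then show "edge_degree F v \<le> 2" for v by (meson add_leD1)
  qed
  have min: "(F, S) \<in> two_matchings n E j" if "(F, S) \<in> min_two_matchings n E j" for F S
    using that unfolding min_two_matchings_def by simp
  have G_le_M: "ideal_gen ?G \<subseteq> ideal_gen ?M"
  proof (rule ideal_gen_subset, rule subsetI)
    fix p assume "p \<in> ?G"
    then obtain F S D where p: "p = d_poly E S D" "(F, S) \<in> min_two_matchings n E j" "path_orientation F D"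
      by blast
    note m = min[OF p(2)]
    note M = match[OF m]
    have o: "orients F D" using p(3) path_orientation_iff_orients[OF f M(1)] by simp
    have "card (heads S D) = j" "card (tails S D) = j"
      using minor_heads_tails(2,3)[OF f M(1) o M(3) two_matching_arcs_avoid_loops[OF f m o]] M(4) by simp_all
    moreover have "heads S D \<subseteq> {0..<n}" "tails S D \<subseteq> {0..<n}"
      using orients_subset(1)[OF f M(1) o] M(2) by (auto simp: heads_def tails_def)
    ultimately have "minor E (heads S D) (tails S D) \<in> ideal_gen ?M" by (intro ideal_gen_base) blast
    then show "p \<in> ideal_gen ?M"
      unfolding p(1) d_poly_def by (rule ideal_gen_eq_up_to_sign[OF sign_normalize_eq_up_to_sign])
  qed
  \<comment> \<open>Some orientation must exist, since otherwise a minimal 2-matching would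
    contribute no generator.\<close>
  have base: "minor E S S \<in> ideal_gen ?G" if m: "(F, S) \<in> min_two_matchings n E j" for F S
  proof -
    note M = match[OF min[OF m]]
    obtain D where o: "orients F D" using forest_orients_exists[OF f M(1,5)] by metis
    have "path_orientation F D" using o path_orientation_iff_orients[OF f M(1)] by simp
    then have d: "d_poly E S D \<in> ideal_gen ?G" using m by (intro ideal_gen_base) blast
    have e1: "eq_up_to_sign (d_poly E S D) (minor E (heads S D) (tails S D))"
      unfolding d_poly_def by (rule eq_up_to_sign_sym[OF sign_normalize_eq_up_to_sign])
    have e2: "eq_up_to_sign (minor E (heads S D) (tails S D)) (minor E S S)"
      by (rule minor_heads_tails(1)[OF f M(1) o M(3) two_matching_arcs_avoid_loops[OF f min[OF m] o]])
    show ?thesis by (rule ideal_gen_eq_up_to_sign[OF eq_up_to_sign_trans[OF e1 e2] d])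
  qed
  have M_le_G: "ideal_gen ?M \<subseteq> ideal_gen ?G"
  proof (rule ideal_gen_subset, rule subsetI)
    fix p assume "p \<in> ?M"
    then obtain R C where RC: "p = minor E R C" "R \<subseteq> {0..<n}" "C \<subseteq> {0..<n}" "card R = j" "card C = j"
      by blast
    show "p \<in> ideal_gen ?G"
    \<comment> \<open>A zero minor need not come from any 2-matching, so it is treated
      apart.\<close>
    proof (cases "p = 0")
      case True
      then show ?thesis using ideal_gen_0 by simp
    next
      case False
      have fin: "finite R" "finite C" using RC(2,3) finite_subset by blast+
      obtain F D S where F: "F \<subseteq> E" and o: "orients F D" and S: "S \<subseteq> R" "heads S D = R" "tails S D = C"
        and disj: "\<And>a b. (a, b) \<in> D \<Longrightarrow> a \<notin> S \<and> b \<notin> S"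
        using minor_nonzero_heads_tails[OF fin, of E] RC False by metis
      have finS: "finite S" using S(1) fin(1) by (rule finite_subset)
      have ht: "eq_up_to_sign (minor E R C) (minor E S S)" "card R = card F + card S"
        using minor_heads_tails(1,2)[OF f F o finS disj, unfolded S(2,3)] by simp_all
      have "S \<subseteq> {0..<n}" using S(1) RC(2) by blast
      from orients_two_matching[OF f F o this disj] have m: "(F, S) \<in> two_matchings n E j"
        using ht(2) RC(4) by simp
      have "minor E S S \<in> ideal_gen ?G" by (rule loops_minor_in_ideal[OF f _ m]) (rule base)
      then show ?thesis unfolding RC(1) by (rule ideal_gen_eq_up_to_sign[OF eq_up_to_sign_sym[OF ht(1)]])
    qed
  qed
  show ?thesis unfolding critical_ideal_def by (rule equalityI[OF M_le_G G_le_M])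
qed

end
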